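(* Let $\mathcal Z$ be a Banach space with data $(\mathfrak X,\lambda,Q)$ as described in the context and suppose Assumption (W) of the context holds. Let $(Z_t)_{t\ge0}$ be the associated piecewise deterministic Markov process and, for bounded measurable $f:\mathcal Z\to\mathbb R$, let $\mathcal P_tf(z)=\mathbb E_z[f(Z_t)]$. Then $\{\mathcal P_t\}_{t\ge0}$ is a Feller semigroup, i.e. $\mathcal P_t(C_b(\mathcal Z))\subseteq C_b(\mathcal Z)$ for every $t\ge 0$.
   Context: Let $(\mathcal Z,\|\cdot\|_{\mathcal Z})$ be a (possibly infinite dimensional) Banach space with its Borel $\sigma$-algebra; $B_R$ is the open ball of radius $R$ centred at $0$; $C_b(\mathcal Z)$ is the space of bounded continuous functions $\mathcal Z\to\mathbb R$. Data. $\mathfrak X:\mathcal Z\to\mathcal Z$ is a vector field generating a flow map $(\varphi_t)_{t\ge0}$, $\frac{d}{dt}\varphi_t(z)=\mathfrak X(\varphi_t(z))$, $\varphi_0(z)=z$, well defined for all $t\ge 0$ and $z\in\mathcal Z$. $\lambda_{\mathrm r},\lambda_{\mathrm b}:\mathcal Z\to[0,\infty)$ are the refreshment and reflection intensities, $Q_{\mathrm r},Q_{\mathrm b}$ the refreshment and reflection kernels. Put $\lambda=\lambda_{\mathrm r}+\lambda_{\mathrm b}$ and let $Q$ be the transition kernel with $\lambda(z)Q(z,\cdot)=\lambda_{\mathrm r}(z)Q_{\mathrm r}(z,\cdot)+\lambda_{\mathrm b}(z)Q_{\mathrm b}(z,\cdot)$. For each $z$ there is $\varepsilon(z)>0$ such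 that $s\mapsto\lambda(\varphi_s(z))$ is integrable on $[0,\varepsilon(z))$; $z\mapsto Q(z,A)$ is measurable for every Borel $A$; and $Q(z,\{z\})=0$ for all $z$. Assumption (W): (i) $\lambda_{\mathrm r},\lambda_{\mathrm b}$ are measurable. (ii) For each $z$, $Q_{\mathrm b}(z,\cdot),Q_{\mathrm r}(z,\cdot)$ are Markov transition kernels on $\mathcal Z$, and $z\mapsto Q_{\mathrm b}f(z)$, $z\mapsto Q_{\mathrm r}f(z)$ are measurable for every bounded measurable $f$. (iii) $Q_{\mathrm b}(z,\{y:\|y\|_{\mathcal Z}\le\|z\|_{\mathcal Z}\})=1$ for all $z\in\mathcal Z$. (iv) For all $\varepsilon>0$ there exists $R>0$ such that $Q_{\mathrm r}(z,B_R)>1-\varepsilon$ for all $z\in B_R$. (v) For all $R>0$, $\sup_{z\in B_R}\lambda_{\mathrm b}(z)<\infty$. (vi) There is $M>0$ with $\lambda_{\mathrm r}(z)\le M$ for all $z\in\mathcal Z$. (vii) There is a continuous function $t\mapsto c_t\in(0,\infty)$ with $\|\varphi_t(z)\|_{\mathcal Z}\le c_t(1+\|z\|_{\mathcal Z})$ for all $z\in\mathcal Z$, $t\ge0$. (viii) $\lambda_{\mathrm r},\lambda_{\mathrm b}$ are continuous and $Q_{\mathrm b}f,Q_{\mathrm r}f$ are continuous for every bounded continuous $f$. Process with characteristics $(\mathfrak X,\lambda,Q)$ (PDMP): started from $z$, the first jump time $T_1$ satisfies $\mathbb P(T_1>t)=\exp(-\int_0^t\lambda(\varphi_s(z))ds)$;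 $Z_t=\varphi_t(z)$ for $0\le t<T_1$; given $T_1<\infty$, $Z_{T_1}$ is distributed according to $Q(\varphi_{T_1}(z),\cdot)$; then the procedure is repeated independently from $Z_{T_1}$, producing successive jump times $T_1,T_2,\dots$ and the path $Z_t$. Under Assumption (W) the paper takes this process to be defined for all $t\ge0$ (non-explosive).
   Formalization: Each flow map φ_t is additionally assumed continuous in z (and to satisfy the semigroup law); without continuity the claim fails, e.g. on ℝ with X(z)=1 for z≥0, X(z)=−1 for z<0 and λ=0, where P_t f = f∘φ_t is discontinuous at 0. *)

theory Defs
  imports "HOL-Probability.Probability"
begin

text \<open>
  The flow is a flow in the usual sense of dynamical systems: it satisfies the semigroup law, and
  every \<open>\<phi> t\<close> is continuous. Well-posedness of the differential equation alone would give neither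
  continuity in the initial condition nor, consequently, the Feller property: for
  \<open>X z = (if z \<ge> 0 then 1 else -1)\<close> on the real line and no jumps, the forward solutions are unique
  and global, but they depend discontinuously on \<open>z\<close>.
\<close>

locale flow_map =
  fixes X :: "'z::banach \<Rightarrow> 'z" and \<phi> :: "real \<Rightarrow> 'z \<Rightarrow> 'z"
  assumes flow_zero: "\<phi> 0 z = z"
    and flow_ode: "t \<ge> 0 \<Longrightarrow> ((\<lambda>s. \<phi> s z) has_vector_derivative X (\<phi> t z)) (at t within {0..})"
    and flow_add: "s \<ge> 0 \<Longrightarrow> t \<ge> 0 \<Longrightarrow> \<phi> (s + t) z = \<phi> t (\<phi> s z)"
    and flow_continuous: "t \<ge> 0 \<Longrightarrow> continuous_on UNIV (\<phi> t)"

text \<open>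
  A Markov transition kernel on the Banach space is an element of
  \<open>borel \<rightarrow>\<^sub>M prob_algebra borel\<close>: every \<open>K z\<close> is a Borel probability measure and
  \<open>z \<mapsto> K z A\<close> is measurable for every Borel set \<open>A\<close>.
\<close>

locale pdmp_data = flow_map X \<phi>
  for X :: "'z::banach \<Rightarrow> 'z" and \<phi> :: "real \<Rightarrow> 'z \<Rightarrow> 'z" +
  fixes rate_r rate_b :: "'z \<Rightarrow> real" and Qr Qb Q :: "'z \<Rightarrow> 'z measure"
  assumes rate_r_nonneg: "rate_r z \<ge> 0"
    and rate_b_nonneg: "rate_b z \<ge> 0"
    and rate_integrable:
      "\<exists>\<epsilon>>0. set_integrable lborel {0..<\<epsilon>} (\<lambda>s. rate_r (\<phi> s z) + rate_b (\<phi> s z))"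
    and Q_kernel: "Q \<in> borel \<rightarrow>\<^sub>M prob_algebra borel"
    and Q_mixture: "A \<in> sets borel \<Longrightarrow>
      (rate_r z + rate_b z) * measure (Q z) A
        = rate_r z * measure (Qr z) A + rate_b z * measure (Qb z) A"
    and Q_no_fixed: "measure (Q z) {z} = 0"

locale assumption_W =
  fixes \<phi> :: "real \<Rightarrow> 'z::banach \<Rightarrow> 'z" and rate_r rate_b :: "'z \<Rightarrow> real"
    and Qr Qb :: "'z \<Rightarrow> 'z measure"
  assumes W1: "rate_r \<in> borel_measurable borel" "rate_b \<in> borel_measurable borel"
    and W2: "Qb \<in> borel \<rightarrow>\<^sub>M prob_algebra borel" "Qr \<in> borel \<rightarrow>\<^sub>M prob_algebra borel"
      "\<And>f :: 'z \<Rightarrow> real. f \<in> borel_measurable borel \<Longrightarrow> bounded (range f) \<Longrightarrow>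
         (\<lambda>z. \<integral>y. f y \<partial>Qb z) \<in> borel_measurable borel"
      "\<And>f :: 'z \<Rightarrow> real. f \<in> borel_measurable borel \<Longrightarrow> bounded (range f) \<Longrightarrow>
         (\<lambda>z. \<integral>y. f y \<partial>Qr z) \<in> borel_measurable borel"
    and W3: "\<And>z. measure (Qb z) {y. norm y \<le> norm z} = 1"
    and W4: "\<And>\<epsilon>. \<epsilon> > 0 \<Longrightarrow> \<exists>R>0. \<forall>z\<in>ball 0 R. measure (Qr z) (ball 0 R) > 1 - \<epsilon>"
    and W5: "\<And>R. R > 0 \<Longrightarrow> bdd_above (rate_b ` ball 0 R)"
    and W6: "\<exists>M>0. \<forall>z. rate_r z \<le> M"
    and W7: "\<exists>c :: real \<Rightarrow> real. continuous_on {0..} c \<and> (\<forall>t\<ge>0. c t > 0) \<and>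
      (\<forall>t\<ge>0. \<forall>z. norm (\<phi> t z) \<le> c t * (1 + norm z))"
    and W8: "continuous_on UNIV rate_r" "continuous_on UNIV rate_b"
      "\<And>f :: 'z \<Rightarrow> real. f \<in> bcontfun \<Longrightarrow> continuous_on UNIV (\<lambda>z. \<integral>y. f y \<partial>Qb z)"
      "\<And>f :: 'z \<Rightarrow> real. f \<in> bcontfun \<Longrightarrow> continuous_on UNIV (\<lambda>z. \<integral>y. f y \<partial>Qr z)"

text \<open>
  \<open>S n\<close> is the waiting time between the \<open>n\<close>-th and the \<open>(n+1)\<close>-st jump (\<open>\<infinity>\<close> if there is no further
  jump), and \<open>Y n\<close> is the position immediately after the \<open>n\<close>-th jump, \<open>Y 0\<close> being the initial
  position. What \<open>S\<close> and \<open>Y\<close> do after an infinite waiting time is irrelevant and left unconstrained.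
\<close>

definition jump_time :: "(nat \<Rightarrow> 'w \<Rightarrow> ennreal) \<Rightarrow> nat \<Rightarrow> 'w \<Rightarrow> ennreal" where
  "jump_time S n \<omega> = (\<Sum>k<n. S k \<omega>)"

text \<open>The \<open>\<sigma>\<close>-algebra generated by \<open>Y 0, \<dots>, Y n\<close> and the first \<open>m\<close> waiting times.\<close>

definition jump_history ::
  "'w measure \<Rightarrow> (nat \<Rightarrow> 'w \<Rightarrow> ennreal) \<Rightarrow> (nat \<Rightarrow> 'w \<Rightarrow> 'z::topological_space) \<Rightarrow>
    nat \<Rightarrow> nat \<Rightarrow> 'w measure" where
  "jump_history M S Y m n = sigma (space M)
     ({S k -` A \<inter> space M | k A. k < m \<and> A \<in> sets borel} \<union>
      {Y k -` A \<inter> space M | k A. k \<le> n \<and> A \<in> sets borel})"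

text \<open>
  \<open>Z\<close> is, on the probability space \<open>M\<close>, a piecewise deterministic Markov process started at \<open>z\<close>, with
  flow \<open>\<phi>\<close>, jump rate \<open>rate\<close> and jump kernel \<open>Q\<close>. The last assumption is non-explosion, i.e. the
  path is defined for all times; the growth condition on the flow in \<open>assumption_W\<close>, which allows a
  constant \<open>c 0 > 1\<close>, does not by itself exclude explosion.
\<close>

locale pdmp_from = prob_space M
  for M :: "'w measure" +
  fixes \<phi> :: "real \<Rightarrow> 'z::banach \<Rightarrow> 'z" and rate :: "'z \<Rightarrow> real" and Q :: "'z \<Rightarrow> 'z measure"
    and z :: 'z and S :: "nat \<Rightarrow> 'w \<Rightarrow> ennreal" and Y :: "nat \<Rightarrow> 'w \<Rightarrow> 'z"
    and Z :: "real \<Rightarrow> 'w \<Rightarrow> 'z"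
  assumes S_measurable: "S n \<in> borel_measurable M"
    and Y_measurable: "Y n \<in> borel_measurable M"
    and Z_measurable: "t \<ge> 0 \<Longrightarrow> Z t \<in> borel_measurable M"
    and initial: "AE \<omega> in M. Y 0 \<omega> = z"
    and waiting_time: "t \<ge> 0 \<Longrightarrow>
      AE \<omega> in M. jump_time S n \<omega> < \<infinity> \<longrightarrow>
        real_cond_exp M (jump_history M S Y n n) (indicator {\<omega> \<in> space M. S n \<omega> > ennreal t}) \<omega>
          = exp (- (LBINT s:{0..t}. rate (\<phi> s (Y n \<omega>))))"
    and jump: "A \<in> sets borel \<Longrightarrow>
      AE \<omega> in M. jump_time S (Suc n) \<omega> < \<infinity> \<longrightarrow>
        real_cond_exp M (jump_history M S Y (Suc n) n) (indicator {\<omega> \<in> space M. Y (Suc n) \<omega> \<in> A}) \<omega>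
          = measure (Q (\<phi> (enn2real (S n \<omega>)) (Y n \<omega>))) A"
    and path: "AE \<omega> in M. \<forall>n. \<forall>t\<ge>0.
      jump_time S n \<omega> \<le> ennreal t \<and> ennreal t < jump_time S (Suc n) \<omega> \<longrightarrow>
        Z t \<omega> = \<phi> (t - enn2real (jump_time S n \<omega>)) (Y n \<omega>)"
    and non_explosive: "AE \<omega> in M. (\<lambda>n. jump_time S n \<omega>) \<longlonglongrightarrow> \<infinity>"

text \<open>\<open>\<P>\<^sub>t f(z) = \<E>\<^sub>z[f(Z\<^sub>t)]\<close>, where \<open>Pr z\<close> is the probability measure of the process started at \<open>z\<close>.\<close>

definition transition_op ::
  "('z \<Rightarrow> 'w measure) \<Rightarrow> (real \<Rightarrow> 'w \<Rightarrow> 'z) \<Rightarrow> real \<Rightarrow> ('z \<Rightarrow> real) \<Rightarrow> 'z \<Rightarrow> real" where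
  "transition_op Pr Z t f z = (\<integral>\<omega>. f (Z t \<omega>) \<partial>Pr z)"

end

theory Submission
  imports Defs
begin

text \<open>
  Conditioning on the last jump before time \<open>t\<close> and peeling off the jumps one by one from the end,
  \<open>\<E>\<^sub>z[f(Z\<^sub>t); T\<^sub>n \<le> t < T\<^sub>n\<^sub>+\<^sub>1] = (K\<^sup>n g)(t, z)\<close>, where
  \<open>g(r, y) = f(\<phi>\<^sub>r y) exp(- \<integral>\<^sub>0\<^sup>r \<lambda>(\<phi>\<^sub>s y) ds)\<close> and \<open>K\<close> integrates over the first jump. Dominated
  convergence shows that \<open>K\<close> preserves continuity in \<open>z\<close>, because \<open>\<lambda>\<close> is bounded on bounded sets
  and \<open>\<lambda> Q h = \<lambda>\<^sub>r Q\<^sub>r h + \<lambda>\<^sub>b Q\<^sub>b h\<close> is continuous for \<open>h \<in> C\<^sub>b\<close>. By non-explosion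
  \<open>\<P>\<^sub>t f = \<Sum>\<^sub>n K\<^sup>n g\<close>, so for \<open>0 \<le> f \<le> 1\<close> both \<open>\<P>\<^sub>t f\<close> and \<open>1 - \<P>\<^sub>t f = \<P>\<^sub>t (1 - f)\<close> are
  suprema of continuous functions, hence lower semicontinuous. No uniform bound on the number of
  jumps is needed.
\<close>

subsection \<open>Disintegration and mixtures of measures\<close>

text \<open>Both sides integrate \<open>h\<close> against a finite measure on
  \<open>E \<Otimes>\<^sub>M N\<close>: the joint law of \<open>(D, V)\<close> on \<open>U\<close>,
  and the law that draws the second component from \<open>\<kappa> (D \<omega>)\<close> on
  \<open>W\<close>. They agree on a generator stable under intersections, hence everywhere.
  \<open>U\<close> and \<open>W\<close> may differ because \<open>\<kappa>\<close> may have mass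
  below 1; \<open>U\<close> can then also record that \<open>V\<close> takes a genuine
  value.\<close>

lemma nn_integral_disintegration:
  assumes "prob_space M"
    and [measurable]: "D \<in> M \<rightarrow>\<^sub>M E" "V \<in> M \<rightarrow>\<^sub>M N" "\<kappa> \<in> E \<rightarrow>\<^sub>M subprob_algebra N"
    and [measurable]: "U \<in> sets M" "W \<in> sets M"
    and G: "Int_stable G" "G \<subseteq> Pow (space N)" "sets N = sigma_sets (space N) G"
      "range A \<subseteq> G" "(\<Union>i::nat. A i) = space N"
    and rect: "\<And>C B. C \<in> sets E \<Longrightarrow> B \<in> G \<Longrightarrow>
      emeasure M {\<omega> \<in> space M. \<omega> \<in> U \<and> D \<omega> \<in> C \<and> V \<omega> \<in> B}
        = (\<integral>\<^sup>+\<omega>. indicator W \<omega> * (indicator C (D \<omega>) * emeasure (\<kappa> (D \<omega>)) B) \<partial>M)"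
    and h[measurable]: "h \<in> borel_measurable (E \<Otimes>\<^sub>M N)"
  shows "(\<integral>\<^sup>+\<omega>. indicator U \<omega> * h (D \<omega>, V \<omega>) \<partial>M)
    = (\<integral>\<^sup>+\<omega>. indicator W \<omega> * (\<integral>\<^sup>+v. h (D \<omega>, v) \<partial>\<kappa> (D \<omega>)) \<partial>M)"
proof -
  interpret prob_space M by fact
  define \<mu> where "\<mu> = distr (density M (indicator U)) (E \<Otimes>\<^sub>M N) (\<lambda>\<omega>. (D \<omega>, V \<omega>))"
  define k where "k = (\<lambda>\<omega>. distr (\<kappa> (D \<omega>)) (E \<Otimes>\<^sub>M N) (\<lambda>v. (D \<omega>, v)))"
  define \<nu> where "\<nu> = density M (indicator W) \<bind> k"
  have k[measurable]: "k \<in> density M (indicator W) \<rightarrow>\<^sub>M subprob_algebra (E \<Otimes>\<^sub>M N)"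
    unfolding k_def by (rule measurable_distr2[where M = N]) measurable
  have kappa_sets: "sets (\<kappa> (D \<omega>)) = sets N" if "\<omega> \<in> space M" for \<omega>
    using that by (intro sets_kernel[where M = E]) (auto intro: measurable_space)
  have kk: "(\<lambda>\<omega>. \<integral>\<^sup>+v. f (D \<omega>, v) \<partial>\<kappa> (D \<omega>)) \<in> borel_measurable M"
    if [measurable]: "f \<in> borel_measurable (E \<Otimes>\<^sub>M N)" for f :: "_ \<Rightarrow> ennreal"
    by (rule nn_integral_measurable_subprob_algebra2[where N = N]) measurable
  have \<mu>_int: "(\<integral>\<^sup>+x. f x \<partial>\<mu>) = (\<integral>\<^sup>+\<omega>. indicator U \<omega> * f (D \<omega>, V \<omega>) \<partial>M)"
    if [measurable]: "f \<in> borel_measurable (E \<Otimes>\<^sub>M N)" for f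
    unfolding \<mu>_def by (simp add: nn_integral_distr nn_integral_density)
  have \<nu>_int: "(\<integral>\<^sup>+x. f x \<partial>\<nu>)
      = (\<integral>\<^sup>+\<omega>. indicator W \<omega> * (\<integral>\<^sup>+v. f (D \<omega>, v) \<partial>\<kappa> (D \<omega>)) \<partial>M)"
    if [measurable]: "f \<in> borel_measurable (E \<Otimes>\<^sub>M N)" for f
  proof -
    have kd: "(\<integral>\<^sup>+y. f y \<partial>k \<omega>) = (\<integral>\<^sup>+v. f (D \<omega>, v) \<partial>\<kappa> (D \<omega>))" if "\<omega> \<in> space M" for \<omega>
    proof -
      have "D \<omega> \<in> space E" using that by (auto intro: measurable_space)
      then have "Pair (D \<omega>) \<in> \<kappa> (D \<omega>) \<rightarrow>\<^sub>M E \<Otimes>\<^sub>M N"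
        by (simp add: measurable_cong_sets[OF kappa_sets[OF that] refl] measurable_Pair1')
      then show ?thesis by (simp add: k_def nn_integral_distr)
    qed
    have "(\<integral>\<^sup>+x. f x \<partial>\<nu>) = (\<integral>\<^sup>+\<omega>. (\<integral>\<^sup>+y. f y \<partial>k \<omega>) \<partial>density M (indicator W))"
      unfolding \<nu>_def by (rule nn_integral_bind[OF _ k]) measurable
    also have "\<dots> = (\<integral>\<^sup>+\<omega>. (\<integral>\<^sup>+v. f (D \<omega>, v) \<partial>\<kappa> (D \<omega>)) \<partial>density M (indicator W))"
      by (rule nn_integral_cong) (simp add: kd)
    also have "\<dots> = (\<integral>\<^sup>+\<omega>. indicator W \<omega> * (\<integral>\<^sup>+v. f (D \<omega>, v) \<partial>\<kappa> (D \<omega>)) \<partial>M)"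
      by (rule nn_integral_density) (simp_all add: kk)
    finally show ?thesis .
  qed
  have "\<mu> = \<nu>"
  proof (rule measure_eqI_generator_eq)
    let ?R = "{C \<times> B | C B. C \<in> sets E \<and> B \<in> G}"
    show "Int_stable ?R"
    proof (rule Int_stableI)
      fix a b assume "a \<in> ?R" "b \<in> ?R"
      then obtain C B C' B' where ab: "a = C \<times> B" "b = C' \<times> B'"
        and C: "C \<in> sets E" "C' \<in> sets E" and B: "B \<in> G" "B' \<in> G" by (elim CollectE exE conjE)
      have "C \<inter> C' \<in> sets E" "B \<inter> B' \<in> G"
        using C Int_stableD[OF \<open>Int_stable G\<close> B] by auto
      moreover have "a \<inter> b = (C \<inter> C') \<times> (B \<inter> B')" by (auto simp: ab)
      ultimately show "a \<inter> b \<in> ?R" by blast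
    qed
    show "?R \<subseteq> Pow (space E \<times> space N)"
      using sets.sets_into_space \<open>G \<subseteq> Pow (space N)\<close> by blast
    have EN: "sets (E \<Otimes>\<^sub>M N) = sigma_sets (space E \<times> space N) ?R"
    proof -
      \<comment> \<open>\<open>G\<close> need not contain \<open>space N\<close>, as with
        half-lines; the countable cover \<open>range A\<close> takes its place.\<close>
      have "sets (E \<Otimes>\<^sub>M N) = sets (sigma (space E \<times> space N) ?R)"
        using G by (intro sets_pair_eq[OF sets.space_closed sets.sigma_sets_eq[symmetric] _ _ _ G(2,3),
            where Ca = "{space E}" and Cb = "range A"]) simp_all
      with \<open>?R \<subseteq> Pow (space E \<times> space N)\<close> show ?thesis by simp
    qed
    show "sets \<mu> = sigma_sets (space E \<times> space N) ?R"
      by (simp add: \<mu>_def EN)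
    show sets_\<nu>: "sets \<nu> = sigma_sets (space E \<times> space N) ?R"
      unfolding \<nu>_def EN[symmetric] by (rule sets_bind[OF sets_kernel[OF k]]) (simp_all add: not_empty)
    have "A i \<in> G" for i using \<open>range A \<subseteq> G\<close> by auto
    then show "range (\<lambda>i. space E \<times> A i) \<subseteq> ?R" by blast
    show "(\<Union>i. space E \<times> A i) = space E \<times> space N"
      using \<open>(\<Union>i. A i) = space N\<close> by auto
    show "emeasure \<mu> (space E \<times> A i) \<noteq> \<infinity>" for i
    proof -
      interpret d: finite_measure "density M (indicator U)"
        by (rule finite_measureI) (simp add: emeasure_density nn_integral_indicator')
      have "finite_measure \<mu>"
        unfolding \<mu>_def by (rule d.finite_measure_distr) measurable
      then show ?thesis by (simp add: finite_measure.emeasure_finite)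
    qed
    fix X assume "X \<in> ?R"
    then obtain C B where X: "X = C \<times> B" and C[measurable]: "C \<in> sets E" and B: "B \<in> G" by blast
    have [measurable]: "B \<in> sets N" using B G by auto
    have X_sets[measurable]: "X \<in> sets (E \<Otimes>\<^sub>M N)" by (simp add: X)
    have "emeasure \<mu> X = (\<integral>\<^sup>+x. indicator X x \<partial>\<mu>)"
      by (simp add: \<mu>_def)
    also have "\<dots> = (\<integral>\<^sup>+\<omega>. indicator U \<omega> * indicator X (D \<omega>, V \<omega>) \<partial>M)"
      by (rule \<mu>_int) measurable
    also have "\<dots> = (\<integral>\<^sup>+\<omega>. indicator {\<omega> \<in> space M. \<omega> \<in> U \<and> D \<omega> \<in> C \<and> V \<omega> \<in> B} \<omega> \<partial>M)"
      by (rule nn_integral_cong) (auto simp: X split: split_indicator)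
    also have "\<dots> = (\<integral>\<^sup>+\<omega>. indicator W \<omega> * (indicator C (D \<omega>) * emeasure (\<kappa> (D \<omega>)) B) \<partial>M)"
      by (simp add: rect[OF C B, symmetric])
    also have "\<dots> = (\<integral>\<^sup>+\<omega>. indicator W \<omega> * (\<integral>\<^sup>+v. indicator X (D \<omega>, v) \<partial>\<kappa> (D \<omega>)) \<partial>M)"
    proof (rule nn_integral_cong)
      fix \<omega> assume "\<omega> \<in> space M"
      have "(\<integral>\<^sup>+v. indicator X (D \<omega>, v) \<partial>\<kappa> (D \<omega>)) = (\<integral>\<^sup>+v. indicator C (D \<omega>) * indicator B v \<partial>\<kappa> (D \<omega>))"
        by (rule nn_integral_cong) (auto simp: X split: split_indicator)
      also have "\<dots> = indicator C (D \<omega>) * emeasure (\<kappa> (D \<omega>)) B"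
        by (rule nn_integral_cmult_indicator) (simp add: kappa_sets[OF \<open>\<omega> \<in> space M\<close>])
      finally show "indicator W \<omega> * (indicator C (D \<omega>) * emeasure (\<kappa> (D \<omega>)) B)
        = indicator W \<omega> * (\<integral>\<^sup>+v. indicator X (D \<omega>, v) \<partial>\<kappa> (D \<omega>))" by simp
    qed
    also have "\<dots> = (\<integral>\<^sup>+x. indicator X x \<partial>\<nu>)"
      by (subst \<nu>_int) simp_all
    also have "\<dots> = emeasure \<nu> X"
      using X_sets by (simp add: sets_\<nu> EN)
    finally show "emeasure \<mu> X = emeasure \<nu> X" .
  qed
  then show ?thesis
    using \<mu>_int[OF h] \<nu>_int[OF h] by simp
qed

text \<open>Standard induction on nonnegative measurable functions. In the limit step both integrals
  on the right increase along the sequence, so the sum of their suprema is the supremum of the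
  sums.\<close>

lemma nn_integral_mixture:
  assumes "sets M = sets N" "sets L = sets N"
    and emeasure_eq: "\<And>A. A \<in> sets N \<Longrightarrow> c * emeasure N A = a * emeasure M A + b * emeasure L A"
    and "f \<in> borel_measurable N"
  shows "c * (\<integral>\<^sup>+x. f x \<partial>N) = a * (\<integral>\<^sup>+x. f x \<partial>M) + b * (\<integral>\<^sup>+x. f x \<partial>L)"
  using \<open>f \<in> borel_measurable N\<close>
proof (induction rule: borel_measurable_induct)
  note [measurable_cong] = \<open>sets M = sets N\<close> \<open>sets L = sets N\<close>
  note sp = sets_eq_imp_space_eq[OF \<open>sets M = sets N\<close>] sets_eq_imp_space_eq[OF \<open>sets L = sets N\<close>]
  {
    case (cong f g)
    have "(\<integral>\<^sup>+x. f x \<partial>K) = (\<integral>\<^sup>+x. g x \<partial>K)" if "space K = space N" for K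
      by (rule nn_integral_cong) (simp add: that cong.hyps)
    with cong.IH show ?case by (simp add: sp)
  next
    case (set A)
    then show ?case using emeasure_eq[OF set] by (simp add: assms)
  next
    case (mult u k)
    note [measurable] = mult(2)
    have "c * (\<integral>\<^sup>+x. k * u x \<partial>N) = k * (c * (\<integral>\<^sup>+x. u x \<partial>N))"
      by (simp add: nn_integral_cmult ac_simps)
    also have "\<dots> = a * (\<integral>\<^sup>+x. k * u x \<partial>M) + b * (\<integral>\<^sup>+x. k * u x \<partial>L)"
      by (simp add: nn_integral_cmult mult.IH distrib_left ac_simps)
    finally show ?case .
  next
    case (add u v)
    note [measurable] = add(1,3)
    show ?case by (simp add: nn_integral_add add.IH distrib_left ac_simps)
  next
    case (seq U)
    note [measurable] = seq(1)
    have inc: "incseq (\<lambda>i. k * (\<integral>\<^sup>+x. U i x \<partial>K))" for k and K :: "'a measure"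
      using \<open>incseq U\<close> by (auto simp: incseq_def le_fun_def intro!: mult_left_mono nn_integral_mono)
    have SUP: "k * (\<integral>\<^sup>+x. (SUP i. U i) x \<partial>K) = (SUP i. k * (\<integral>\<^sup>+x. U i x \<partial>K))"
      if [measurable_cong]: "sets K = sets N" for k K
      using \<open>incseq U\<close>
      by (simp add: image_comp nn_integral_monotone_convergence_SUP SUP_mult_left_ennreal)
    show ?case
      by (simp only: SUP assms ennreal_SUP_add[OF inc inc, symmetric] seq.IH)
  }
qed

text \<open>Rounding the time up to a grid of mesh \<open>1 / Suc i\<close> leaves countably many
  time values, each with a measurable slice, and continuity in time gives pointwise convergence as
  the mesh shrinks. Rounding up keeps the times in the half-line where \<open>F\<close> is
  controlled.\<close>

lemma Caratheodory_measurable: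
  fixes F :: "real \<Rightarrow> 'a::topological_space \<Rightarrow> 'b::metric_space"
  assumes meas: "\<And>s. s \<ge> 0 \<Longrightarrow> F s \<in> borel_measurable borel"
    and cont: "\<And>y. continuous_on {0..} (\<lambda>s. F s y)"
  shows "(\<lambda>(s, y). F (max 0 s) y) \<in> borel_measurable (borel \<Otimes>\<^sub>M borel)"
proof (rule borel_measurable_LIMSEQ_metric)
  define G where "G = (\<lambda>i (s, y). F (real (nat \<lceil>max 0 s * real (Suc i)\<rceil>) / real (Suc i)) y)"
  show "G i \<in> borel_measurable (borel \<Otimes>\<^sub>M borel)" for i
  proof -
    have "(\<lambda>p. F (real (nat \<lceil>max 0 (fst p) * real (Suc i)\<rceil>) / real (Suc i)) (snd p))
        \<in> borel_measurable (borel \<Otimes>\<^sub>M borel)"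
    proof (rule measurable_compose_countable'[where I = UNIV and f = "\<lambda>n p. F (real n / real (Suc i)) (snd p)"
          and g = "\<lambda>p. nat \<lceil>max 0 (fst p) * real (Suc i)\<rceil>"])
      show "(\<lambda>p. F (real n / real (Suc i)) (snd p)) \<in> borel_measurable (borel \<Otimes>\<^sub>M borel)" for n
        by (rule measurable_compose[OF measurable_snd meas]) simp
      show "(\<lambda>p :: real \<times> 'a. nat \<lceil>max 0 (fst p) * real (Suc i)\<rceil>)
          \<in> borel \<Otimes>\<^sub>M borel \<rightarrow>\<^sub>M count_space UNIV"
        by measurable
    qed simp
    then show ?thesis by (simp add: G_def case_prod_unfold)
  qed
  fix x :: "real \<times> 'a"
  obtain s y where x: "x = (s, y)" by fastforce
  define q where "q = (\<lambda>i. real (nat \<lceil>max 0 s * real (Suc i)\<rceil>) / real (Suc i))"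
  \<comment> \<open>The rounded time exceeds \<open>max 0 s\<close> by at most one mesh
    width.\<close>
  have "q \<longlonglongrightarrow> max 0 s"
  proof (rule real_tendsto_sandwich)
    have ceil: "max 0 s * real (Suc i) \<le> real (nat \<lceil>max 0 s * real (Suc i)\<rceil>)"
      "real (nat \<lceil>max 0 s * real (Suc i)\<rceil>) \<le> max 0 s * real (Suc i) + 1" for i
      by (rule real_nat_ceiling_ge) (simp add: of_int_ceiling_le_add_one del: of_nat_Suc)
    have "max 0 s \<le> q i" for i
      unfolding q_def by (rule pos_le_divide_eq[THEN iffD2, OF _ ceil(1)]) simp
    then show "\<forall>\<^sub>F i in sequentially. max 0 s \<le> q i"
      by (intro always_eventually allI)
    have "q i \<le> max 0 s + inverse (real (Suc i))" for i
    proof -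
      have "q i \<le> (max 0 s * real (Suc i) + 1) / real (Suc i)"
        unfolding q_def by (rule divide_right_mono[OF ceil(2)]) simp
      also have "\<dots> = max 0 s + inverse (real (Suc i))"
        by (simp add: add_divide_distrib inverse_eq_divide del: of_nat_Suc)
      finally show ?thesis .
    qed
    then show "\<forall>\<^sub>F i in sequentially. q i \<le> max 0 s + inverse (real (Suc i))"
      by (intro always_eventually allI)
    show "(\<lambda>i. max 0 s + inverse (real (Suc i))) \<longlonglongrightarrow> max 0 s"
      using tendsto_add[OF tendsto_const LIMSEQ_inverse_real_of_nat] by simp
  qed simp
  moreover have "q i \<ge> 0" for i
    unfolding q_def by (intro divide_nonneg_nonneg of_nat_0_le_iff)
  ultimately have "(\<lambda>i. F (q i) y) \<longlonglongrightarrow> F (max 0 s) y"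
    by (intro continuous_on_tendsto_compose[OF cont]) auto
  then show "(\<lambda>i. G i x) \<longlonglongrightarrow> (case x of (s, y) \<Rightarrow> F (max 0 s) y)"
    by (simp add: x G_def q_def)
qed

subsection \<open>The one-jump operator\<close>

locale pdmp_W = pdmp_data X \<phi> rate_r rate_b Qr Qb Q + assumption_W \<phi> rate_r rate_b Qr Qb
  for X :: "'z::banach \<Rightarrow> 'z" and \<phi> :: "real \<Rightarrow> 'z \<Rightarrow> 'z"
    and rate_r rate_b :: "'z \<Rightarrow> real" and Qr Qb Q :: "'z \<Rightarrow> 'z measure"
begin

abbreviation rate :: "'z \<Rightarrow> real" where "rate \<equiv> \<lambda>y. rate_r y + rate_b y"

text \<open>Freezing the flow at time 0 for negative arguments gives a function on the whole real
  line, so that measurability and continuity in time carry no side condition.\<close>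

definition flow :: "real \<Rightarrow> 'z \<Rightarrow> 'z" where "flow s = \<phi> (max 0 s)"

text \<open>The integrated hazard along the flow line. Written with an indicator, it is visibly
  jointly measurable in \<open>t\<close> and \<open>y\<close>, and it is 0 for negative
  \<open>t\<close>.\<close>

definition cum_rate :: "real \<Rightarrow> 'z \<Rightarrow> real" where
  "cum_rate t y = (\<integral>s. indicator {0..t} s * rate (flow s y) \<partial>lborel)"

text \<open>Hazard times survival probability, the density of the first waiting time from
  \<open>y\<close>. Its mass may be below 1; the deficit is the probability of never
  jumping.\<close>

definition jump_density :: "'z \<Rightarrow> real \<Rightarrow> real" where
  "jump_density y s = indicator {0..} s * (rate (flow s y) * exp (- cum_rate s y))"

section \<open>Regularity of the flow and of the jump intensity along it\<close>

lemma rate_nonneg: "rate y \<ge> 0"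
  using rate_r_nonneg rate_b_nonneg by (simp add: add_nonneg_nonneg)

lemma flow_continuous_time: "continuous_on A (\<lambda>s. flow s y)"
proof -
  have "continuous_on {0..} (\<lambda>s. \<phi> s y)"
    using flow_ode has_vector_derivative_continuous unfolding continuous_on_eq_continuous_within by blast
  then have "continuous_on A ((\<lambda>s. \<phi> s y) \<circ> max 0)"
    by (intro continuous_on_compose continuous_intros) (auto intro: continuous_on_subset)
  then show ?thesis by (simp add: flow_def comp_def)
qed

lemma flow_continuous_space: "continuous_on UNIV (flow s)"
  by (simp add: flow_def flow_continuous)

text \<open>Each time slice is continuous in space, and each orbit is continuous in time because it
  is differentiable, so the Caratheodory argument applies.\<close>

lemma flow_measurable[measurable]:
  "(\<lambda>p. flow (fst p) (snd p)) \<in> borel_measurable (borel \<Otimes>\<^sub>M borel)"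
proof -
  have "continuous_on {0..} (\<lambda>s. \<phi> s y)" for y
    using flow_continuous_time[of "{0..}" y] by (rule continuous_on_eq) (simp add: flow_def)
  with flow_continuous show ?thesis
    using Caratheodory_measurable[of \<phi>]
    by (simp add: flow_def case_prod_unfold borel_measurable_continuous_onI)
qed

lemma flow_measurable'[measurable (raw)]:
  assumes "f \<in> borel_measurable M" "g \<in> borel_measurable M"
  shows "(\<lambda>x. flow (f x) (g x)) \<in> borel_measurable M"
  using measurable_compose[OF measurable_Pair[OF assms] flow_measurable] by simp

lemma rate_continuous: "continuous_on UNIV rate"
  using W8(1,2) by (intro continuous_intros)

lemma rate_measurable[measurable]: "rate_r \<in> borel_measurable borel" "rate_b \<in> borel_measurable borel"
  by (rule W1)+

lemma rate_flow_continuous: "continuous_on A (\<lambda>s. rate (flow s y))"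
  using continuous_on_compose2[OF rate_continuous flow_continuous_time] by simp

lemma cum_rate_measurable[measurable (raw)]:
  assumes [measurable]: "f \<in> borel_measurable M" "g \<in> borel_measurable M"
  shows "(\<lambda>x. cum_rate (f x) (g x)) \<in> borel_measurable M"
  unfolding cum_rate_def indicator_def[of "{_.._}"] atLeastAtMost_iff by measurable

lemma jump_density_measurable[measurable (raw)]:
  assumes [measurable]: "f \<in> borel_measurable M" "g \<in> borel_measurable M"
  shows "(\<lambda>x. jump_density (g x) (f x)) \<in> borel_measurable M"
  unfolding jump_density_def by measurable

lemma jump_density_nonneg: "jump_density y s \<ge> 0"
  by (simp add: jump_density_def rate_nonneg)

lemma cum_rate_eq: "t \<ge> 0 \<Longrightarrow> cum_rate t y = (LBINT s:{0..t}. rate (\<phi> s y))"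
  unfolding cum_rate_def set_lebesgue_integral_def
  by (intro Bochner_Integration.integral_cong) (auto simp: flow_def split: split_indicator)

lemma cum_rate_nonneg: "cum_rate t y \<ge> 0"
  unfolding cum_rate_def by (intro integral_nonneg_AE) (simp add: rate_nonneg)

lemma cum_rate_eq_integral: "cum_rate t y = integral {0..t} (\<lambda>s. rate (flow s y))"
  using set_borel_integral_eq_integral(2)[OF borel_integrable_atLeastAtMost'[OF rate_flow_continuous]]
  by (simp add: cum_rate_def set_lebesgue_integral_def)

lemma cum_rate_has_derivative:
  assumes "0 \<le> t" "t \<le> b"
  shows "((\<lambda>t. cum_rate t y) has_real_derivative rate (flow t y)) (at t within {0..b})"
  unfolding cum_rate_eq_integral
  by (rule integral_has_real_derivative[OF rate_flow_continuous]) (use assms in auto)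

section \<open>Law of the first waiting time\<close>

lemma jump_density_atMost:
  "(\<integral>\<^sup>+s. ennreal (jump_density y s) * indicator {..b} s \<partial>lborel)
    = ennreal (if b \<ge> 0 then 1 - exp (- cum_rate b y) else 0)"
proof (cases "b \<ge> 0")
  case True
  have 0: "cum_rate 0 y = 0"
    by (simp add: cum_rate_eq_integral)
  have cont: "continuous_on {0..b} (\<lambda>s. cum_rate s y)"
    using cum_rate_has_derivative by (auto intro!: DERIV_continuous_on)
  \<comment> \<open>The survival function is \<open>exp (- cum_rate s y)\<close>; its negative is an
    antiderivative of the density on \<open>{0..b}\<close>.\<close>
  have "has_bochner_integral lborel (\<lambda>s. indicator {0..b} s *\<^sub>R (rate (flow s y) * exp (- cum_rate s y)))
      (- exp (- cum_rate b y) - - exp (- cum_rate 0 y))"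
  proof (rule has_bochner_integral_FTC_Icc[OF True])
    show "continuous_on {0..b} (\<lambda>s. rate (flow s y) * exp (- cum_rate s y))"
      by (intro continuous_intros cont rate_flow_continuous)
    show "((\<lambda>s. - exp (- cum_rate s y)) has_vector_derivative rate (flow s y) * exp (- cum_rate s y))
        (at s within {0..b})" if "0 \<le> s" "s \<le> b" for s
      unfolding has_real_derivative_iff_has_vector_derivative[symmetric]
      by (rule derivative_eq_intros cum_rate_has_derivative that refl | simp add: algebra_simps)+
  qed
  moreover have "indicator {0..b} s *\<^sub>R (rate (flow s y) * exp (- cum_rate s y)) = jump_density y s * indicator {..b} s" for s
    by (auto simp: jump_density_def split: split_indicator)
  ultimately have "has_bochner_integral lborel (\<lambda>s. jump_density y s * indicator {..b} s) (1 - exp (- cum_rate b y))"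
    by (simp add: 0)
  then have "(\<integral>\<^sup>+s. ennreal (jump_density y s * indicator {..b} s) \<partial>lborel) = ennreal (1 - exp (- cum_rate b y))"
    by (intro nn_integral_has_integral_lborel nn_integral_eq_integral[THEN trans])
      (auto simp: has_bochner_integral_iff jump_density_nonneg)
  with True show ?thesis
    by (simp add: ennreal_mult'' ennreal_indicator[symmetric] del: ennreal_indicator)
next
  case False
  then have "(\<integral>\<^sup>+s. ennreal (jump_density y s) * indicator {..b} s \<partial>lborel) = (\<integral>\<^sup>+s. 0 \<partial>(lborel :: real measure))"
    by (intro nn_integral_cong) (auto simp: jump_density_def split: split_indicator)
  with False show ?thesis by simp
qed

text \<open>Exhausting the line by half-lines, the mass is the supremum of
  \<open>1 - exp (- cum_rate n y)\<close> over natural numbers \<open>n\<close>. It stays below 1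
  when the total hazard is finite.\<close>

lemma jump_density_total: "(\<integral>\<^sup>+s. ennreal (jump_density y s) \<partial>lborel) \<le> 1"
proof -
  have "(\<integral>\<^sup>+s. ennreal (jump_density y s) \<partial>lborel)
      = (SUP n::nat. \<integral>\<^sup>+s. ennreal (jump_density y s) * indicator {..real n} s \<partial>lborel)"
  proof (subst nn_integral_monotone_convergence_SUP[symmetric])
    show "incseq (\<lambda>n s. ennreal (jump_density y s) * indicator {..real n} s)"
      by (auto simp: incseq_def le_fun_def split: split_indicator)
    have "(SUP n. ennreal (jump_density y s) * indicator {..real n} s) = ennreal (jump_density y s)" for s
    proof (rule antisym)
      obtain n :: nat where "s \<le> real n" using real_arch_simple by blast
      then show "ennreal (jump_density y s) \<le> (SUP n. ennreal (jump_density y s) * indicator {..real n} s)"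
        by (intro SUP_upper2[of n]) auto
    qed (auto intro!: SUP_least split: split_indicator)
    then show "(\<integral>\<^sup>+s. ennreal (jump_density y s) \<partial>lborel)
      = (\<integral>\<^sup>+s. (SUP n. ennreal (jump_density y s) * indicator {..real n} s) \<partial>lborel)" by simp
  qed measurable
  also have "\<dots> \<le> 1"
    unfolding jump_density_atMost by (intro SUP_least) (auto simp: ennreal_le_1)
  finally show ?thesis .
qed

lemma jump_density_kernel:
  "(\<lambda>y. density lborel (\<lambda>s. ennreal (jump_density y s))) \<in> borel \<rightarrow>\<^sub>M subprob_algebra borel"
proof (rule measurable_subprob_algebra)
  show "subprob_space (density lborel (\<lambda>s. ennreal (jump_density y s)))" for y
    by (rule subprob_spaceI) (simp_all add: emeasure_density jump_density_total)
  fix A :: "real set" assume [measurable]: "A \<in> sets borel"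
  show "(\<lambda>y. emeasure (density lborel (\<lambda>s. ennreal (jump_density y s))) A) \<in> borel_measurable borel"
    by (simp add: emeasure_density)
qed simp

section \<open>Integrals against the jump kernels\<close>

lemma prob_kernel:
  assumes "K \<in> borel \<rightarrow>\<^sub>M prob_algebra borel"
  shows "prob_space (K y)" "sets (K y) = sets borel" "space (K y) = UNIV"
  using measurable_space[OF assms, of y] by (auto simp: space_prob_algebra dest: sets_eq_imp_space_eq)

lemma integral_prob_kernel:
  fixes g :: "'z \<Rightarrow> real"
  assumes K: "K \<in> borel \<rightarrow>\<^sub>M prob_algebra borel"
    and g: "g \<in> borel_measurable borel" "\<And>x. 0 \<le> g x" "\<And>x. g x \<le> 1"
  shows "ennreal (\<integral>x. g x \<partial>K y) = (\<integral>\<^sup>+x. ennreal (g x) \<partial>K y)"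
    and "(\<integral>x. g x \<partial>K y) \<ge> 0" and "(\<integral>x. g x \<partial>K y) \<le> 1"
proof -
  interpret prob_space "K y" by (rule prob_kernel[OF K])
  have [measurable]: "g \<in> borel_measurable (K y)"
    using g(1) by (simp add: measurable_cong_sets[OF prob_kernel(2)[OF K] refl])
  have "integrable (K y) g"
    by (rule integrable_const_bound[where B = 1]) (use g in auto)
  then show "ennreal (\<integral>x. g x \<partial>K y) = (\<integral>\<^sup>+x. ennreal (g x) \<partial>K y)" "(\<integral>x. g x \<partial>K y) \<le> 1"
    using g by (auto intro!: nn_integral_eq_integral[symmetric] integral_le_const)
qed (simp add: g)

text \<open>Continuity is assumed for integrals against \<open>Qr\<close> and \<open>Qb\<close>.
  This identity carries it over to the product of \<open>rate\<close> with the integral against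
  \<open>Q\<close>, which is the combination occurring in the jump operator; control of the integral
  against \<open>Q\<close> by itself is lost where the rate vanishes.\<close>

lemma Q_mixture_integral:
  fixes g :: "'z \<Rightarrow> real"
  assumes g: "g \<in> borel_measurable borel" "\<And>x. 0 \<le> g x" "\<And>x. g x \<le> 1"
  shows "rate y * (\<integral>x. g x \<partial>Q y) = rate_r y * (\<integral>x. g x \<partial>Qr y) + rate_b y * (\<integral>x. g x \<partial>Qb y)"
proof -
  note kernels = Q_kernel W2(1,2)
  interpret Q: prob_space "Q y" by (rule prob_kernel[OF Q_kernel])
  interpret Qr: prob_space "Qr y" by (rule prob_kernel[OF W2(2)])
  interpret Qb: prob_space "Qb y" by (rule prob_kernel[OF W2(1)])
  have "ennreal (rate y) * emeasure (Q y) A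
      = ennreal (rate_r y) * emeasure (Qr y) A + ennreal (rate_b y) * emeasure (Qb y) A"
    if "A \<in> sets (Q y)" for A
    using that Q_mixture[of A y] rate_nonneg rate_r_nonneg rate_b_nonneg
    by (simp add: Q.emeasure_eq_measure Qr.emeasure_eq_measure Qb.emeasure_eq_measure prob_kernel[OF Q_kernel]
        ennreal_mult[symmetric] ennreal_plus[symmetric] del: ennreal_plus)
  then have "ennreal (rate y) * (\<integral>\<^sup>+x. ennreal (g x) \<partial>Q y)
      = ennreal (rate_r y) * (\<integral>\<^sup>+x. ennreal (g x) \<partial>Qr y) + ennreal (rate_b y) * (\<integral>\<^sup>+x. ennreal (g x) \<partial>Qb y)"
    by (rule nn_integral_mixture[rotated 2])
      (use g(1) in \<open>simp_all add: prob_kernel[OF kernels(1)] prob_kernel[OF kernels(2)] prob_kernel[OF kernels(3)]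
        measurable_cong_sets[OF prob_kernel(2)[OF kernels(1)] refl]\<close>)
  moreover note integral_prob_kernel(1,2)[OF kernels(1) g, of y] integral_prob_kernel(1,2)[OF kernels(2) g, of y]
    integral_prob_kernel(1,2)[OF kernels(3) g, of y] rate_r_nonneg[of y] rate_b_nonneg[of y]
  ultimately have "ennreal (rate y * (\<integral>x. g x \<partial>Q y))
      = ennreal (rate_r y * (\<integral>x. g x \<partial>Qr y) + rate_b y * (\<integral>x. g x \<partial>Qb y))"
    by (simp add: ennreal_mult del: ennreal_plus) (simp add: ennreal_mult)
  then show ?thesis
    by (rule ennreal_inj[THEN iffD1, rotated 2])
      (simp_all add: integral_prob_kernel(2)[OF kernels(1) g] integral_prob_kernel(2)[OF kernels(2) g]
        integral_prob_kernel(2)[OF kernels(3) g] rate_r_nonneg rate_b_nonneg)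
qed

text \<open>Here \<open>r\<close> is the time left and \<open>y\<close> the current position.
  Continuity is asked in \<open>y\<close> alone and for \<open>r \<ge> 0\<close>, whereas the unit
  bounds hold for all \<open>r\<close>, so that integrals over \<open>g\<close> exist without side
  conditions.\<close>

definition admissible :: "(real \<Rightarrow> 'z \<Rightarrow> real) \<Rightarrow> bool" where
  "admissible g \<longleftrightarrow> (\<lambda>p. g (fst p) (snd p)) \<in> borel_measurable (borel \<Otimes>\<^sub>M borel) \<and>
    (\<forall>r y. 0 \<le> g r y \<and> g r y \<le> 1) \<and> (\<forall>r\<ge>0. continuous_on UNIV (g r))"

text \<open>The operator \<open>K\<close> of the outline: the first jump comes at time
  \<open>s \<le> r\<close>, the point moves according to \<open>Q\<close>, and \<open>g\<close>
  takes over with the time \<open>r - s\<close> left.\<close>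

definition jump_op :: "(real \<Rightarrow> 'z \<Rightarrow> real) \<Rightarrow> real \<Rightarrow> 'z \<Rightarrow> real" where
  "jump_op g r y =
    (\<integral>s. indicator {0..r} s * (jump_density y s * (\<integral>x. g (r - s) x \<partial>Q (flow s y))) \<partial>lborel)"

lemma admissible_measurable:
  assumes "admissible g" "f \<in> borel_measurable M" "h \<in> borel_measurable M"
  shows "(\<lambda>x. g (f x) (h x)) \<in> borel_measurable M"
  using measurable_compose[OF measurable_Pair[OF assms(2,3)], of "\<lambda>p. g (fst p) (snd p)"] assms(1)
  by (simp add: admissible_def)

lemma admissible_bounds: "admissible g \<Longrightarrow> 0 \<le> g r y" "admissible g \<Longrightarrow> g r y \<le> 1"
  by (simp_all add: admissible_def)

lemma admissible_section_measurable: "admissible g \<Longrightarrow> g r \<in> borel_measurable borel"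
  using admissible_measurable[of g "\<lambda>_. r" borel "\<lambda>x. x"] by simp

lemma integral_Q_admissible:
  assumes g: "admissible g"
  shows "ennreal (\<integral>x. g r x \<partial>Q y) = (\<integral>\<^sup>+x. ennreal (g r x) \<partial>Q y)"
    and "(\<integral>x. g r x \<partial>Q y) \<ge> 0" and "(\<integral>x. g r x \<partial>Q y) \<le> 1"
  using integral_prob_kernel[OF Q_kernel admissible_section_measurable[OF g] admissible_bounds[OF g]] by blast+

lemma nn_integral_Q_measurable:
  assumes g: "admissible g" and f[measurable]: "f \<in> borel_measurable M" and h[measurable]: "h \<in> borel_measurable M"
  shows "(\<lambda>x. \<integral>\<^sup>+v. ennreal (g (f x) v) \<partial>Q (h x)) \<in> borel_measurable M"
proof (rule nn_integral_measurable_subprob_algebra2[where N = borel])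
  show "(\<lambda>(x, v). ennreal (g (f x) v)) \<in> borel_measurable (M \<Otimes>\<^sub>M borel)"
    unfolding case_prod_unfold by (intro measurable_compose[OF _ measurable_ennreal] admissible_measurable[OF g]) measurable
  show "(\<lambda>x. Q (h x)) \<in> M \<rightarrow>\<^sub>M subprob_algebra borel"
    by (rule measurable_compose[OF h measurable_prob_algebraD[OF Q_kernel]])
qed

text \<open>Measurability of kernel integrals is available for nonnegative integrals; the bounds on
  \<open>g\<close> allow the return to the real integral through \<open>enn2real\<close>.\<close>

lemma integral_Q_measurable:
  assumes g: "admissible g" and "f \<in> borel_measurable M" "h \<in> borel_measurable M"
  shows "(\<lambda>x. \<integral>v. g (f x) v \<partial>Q (h x)) \<in> borel_measurable M"
proof -
  have "(\<lambda>x. enn2real (\<integral>\<^sup>+v. ennreal (g (f x) v) \<partial>Q (h x))) \<in> borel_measurable M"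
    by (intro borel_measurable_enn2real nn_integral_Q_measurable assms)
  then show ?thesis
    by (simp add: integral_Q_admissible(1)[OF g, symmetric] integral_Q_admissible(2)[OF g])
qed

text \<open>The integrand is nonnegative and at most \<open>jump_density\<close>, whose mass is at
  most 1. This yields integrability, the passage to the nonnegative integral and the upper bound
  together.\<close>

lemma jump_op_nn_integral:
  assumes g: "admissible g"
  shows "ennreal (jump_op g r y) = (\<integral>\<^sup>+s. ennreal (jump_density y s) *
      (indicator {0..r} s * (\<integral>\<^sup>+x. ennreal (g (r - s) x) \<partial>Q (flow s y))) \<partial>lborel)"
    and "jump_op g r y \<ge> 0" and "jump_op g r y \<le> 1"
proof -
  let ?f = "\<lambda>s. indicator {0..r} s * (jump_density y s * (\<integral>x. g (r - s) x \<partial>Q (flow s y)))"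
  have [measurable]: "(\<lambda>s. \<integral>x. g (r - s) x \<partial>Q (flow s y)) \<in> borel_measurable borel"
    by (rule integral_Q_measurable[OF g]) measurable
  have nonneg: "?f s \<ge> 0" for s
    by (simp add: jump_density_nonneg integral_Q_admissible(2)[OF g])
  have le: "(\<integral>\<^sup>+s. ennreal (?f s) \<partial>lborel) \<le> 1"
  proof -
    have "?f s \<le> jump_density y s" for s
      using mult_left_mono[OF integral_Q_admissible(3)[OF g] jump_density_nonneg]
      by (auto simp: jump_density_nonneg split: split_indicator)
    then have "(\<integral>\<^sup>+s. ennreal (?f s) \<partial>lborel) \<le> (\<integral>\<^sup>+s. ennreal (jump_density y s) \<partial>lborel)"
      by (intro nn_integral_mono ennreal_leI)
    with jump_density_total show ?thesis by (rule order_trans[rotated])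
  qed
  have eq: "ennreal (jump_op g r y) = (\<integral>\<^sup>+s. ennreal (?f s) \<partial>lborel)"
    unfolding jump_op_def
  proof (rule nn_integral_eq_integral[symmetric])
    show "integrable lborel ?f"
      by (rule integrableI_nonneg) (use nonneg le in \<open>auto intro: le_less_trans\<close>)
  qed (simp add: nonneg)
  show "jump_op g r y \<ge> 0"
    unfolding jump_op_def by (intro integral_nonneg_AE) (simp add: nonneg)
  then show "jump_op g r y \<le> 1"
    using le unfolding eq[symmetric] by simp
  have "ennreal (?f s) = ennreal (jump_density y s) *
      (indicator {0..r} s * (\<integral>\<^sup>+x. ennreal (g (r - s) x) \<partial>Q (flow s y)))" for s
    by (simp add: integral_Q_admissible(1)[OF g, symmetric] integral_Q_admissible(2)[OF g] ennreal_mult jump_density_nonneg split: split_indicator)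
  then show "ennreal (jump_op g r y) = (\<integral>\<^sup>+s. ennreal (jump_density y s) *
      (indicator {0..r} s * (\<integral>\<^sup>+x. ennreal (g (r - s) x) \<partial>Q (flow s y))) \<partial>lborel)"
    unfolding eq by simp
qed

section \<open>Continuity in the starting point\<close>

text \<open>Bounded sets need not be relatively compact in infinite dimension, so the bound is
  obtained from norms: a convergent sequence is bounded, \<open>W7\<close> with \<open>c\<close>
  bounded on \<open>[0, r]\<close> keeps all its orbits up to time \<open>r\<close> in one ball, and
  there \<open>W5\<close> and \<open>W6\<close> bound the rates.\<close>

lemma rate_flow_bounded:
  assumes "u \<longlonglongrightarrow> y" "r \<ge> 0"
  obtains L where "\<And>k s. 0 \<le> s \<Longrightarrow> s \<le> r \<Longrightarrow> rate (flow s (u k)) \<le> L"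
proof -
  obtain B where B: "norm (u k) \<le> B" for k
    using convergent_imp_bounded[OF \<open>u \<longlonglongrightarrow> y\<close>] by (auto simp: bounded_iff)
  obtain c where c: "continuous_on {0..} c" "\<And>t z. t \<ge> 0 \<Longrightarrow> norm (\<phi> t z) \<le> c t * (1 + norm z)"
    using W7 by blast
  have "continuous_on {0..r} c" using c(1) by (rule continuous_on_subset) auto
  then obtain C where C: "\<And>s. 0 \<le> s \<Longrightarrow> s \<le> r \<Longrightarrow> c s \<le> C"
    using continuous_attains_sup[of "{0..r}" c] \<open>r \<ge> 0\<close> by fastforce
  \<comment> \<open>The added 1 turns the norm estimate into a strict one, since \<open>W5\<close>
    speaks of open balls.\<close>
  define R where "R = \<bar>C\<bar> * (1 + B) + 1"
  have "B \<ge> 0" using B[of 0] norm_ge_zero order_trans by blast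
  then have "R > 0" by (simp add: R_def add_nonneg_pos)
  obtain b where b: "\<And>z. z \<in> ball 0 R \<Longrightarrow> rate_b z \<le> b"
    using W5[OF \<open>R > 0\<close>] unfolding bdd_above_def by blast
  obtain m where m: "\<And>z. rate_r z \<le> m" using W6 by blast
  show thesis
  proof (rule that[of "m + b"])
    fix s :: real and k :: nat assume s: "0 \<le> s" "s \<le> r"
    have "norm (flow s (u k)) \<le> c s * (1 + norm (u k))"
      using c(2)[OF s(1)] s by (simp add: flow_def)
    also have "\<dots> \<le> \<bar>C\<bar> * (1 + B)"
      using C[OF s] B[of k] by (intro mult_mono) auto
    finally have "flow s (u k) \<in> ball 0 R" by (simp add: R_def)
    then show "rate (flow s (u k)) \<le> m + b" using b m by (simp add: add_mono)
  qed
qed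

text \<open>Dominated convergence along sequences: the rates along the orbits converge by continuity
  of the flow and the rates, and share a bound on \<open>[0, r]\<close>.\<close>

lemma cum_rate_continuous:
  assumes "r \<ge> 0"
  shows "continuous_on UNIV (cum_rate r)"
  unfolding continuous_on_sequentially
proof (safe, unfold comp_def)
  fix u and y :: 'z assume u: "u \<longlonglongrightarrow> y"
  obtain L where L: "\<And>k s. 0 \<le> s \<Longrightarrow> s \<le> r \<Longrightarrow> rate (flow s (u k)) \<le> L"
    using rate_flow_bounded[OF u assms] by blast
  show "(\<lambda>k. cum_rate r (u k)) \<longlonglongrightarrow> cum_rate r y"
    unfolding cum_rate_def
  proof (rule integral_dominated_convergence[where w = "\<lambda>s. indicator {0..r} s * L"])
    have "(\<lambda>k. rate (flow s (u k))) \<longlonglongrightarrow> rate (flow s y)" for s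
      by (rule continuous_on_tendsto_compose[OF rate_continuous])
        (auto intro: continuous_on_tendsto_compose[OF flow_continuous_space u])
    then show "AE s in lborel. (\<lambda>k. indicator {0..r} s * rate (flow s (u k))) \<longlonglongrightarrow> indicator {0..r} s * rate (flow s y)"
      by (intro AE_I2 tendsto_mult tendsto_const)
    show "AE s in lborel. norm (indicator {0..r} s * rate (flow s (u k))) \<le> indicator {0..r} s * L" for k
      using L rate_nonneg by (intro AE_I2) (auto simp: abs_mult split: split_indicator)
  qed (use borel_integrable_atLeastAtMost'[of 0 r "\<lambda>_. L"] in \<open>auto simp: set_integrable_def\<close>)
qed

text \<open>Dominated convergence with the same kind of bound \<open>L\<close>; the other two
  factors, the survival probability and the integral of \<open>g\<close>, are at most 1.\<close>

lemma jump_op_continuous: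
  assumes g: "admissible g" and "r \<ge> 0"
  shows "continuous_on UNIV (jump_op g r)"
  unfolding continuous_on_sequentially
proof (safe, unfold comp_def)
  fix u and y :: 'z assume u: "u \<longlonglongrightarrow> y"
  let ?I = "\<lambda>y s. \<integral>x. g (r - s) x \<partial>Q (flow s y)"
  obtain L where L: "\<And>k s. 0 \<le> s \<Longrightarrow> s \<le> r \<Longrightarrow> rate (flow s (u k)) \<le> L"
    using rate_flow_bounded[OF u assms(2)] by blast
  have [measurable]: "(\<lambda>s. ?I y s) \<in> borel_measurable borel" for y
    by (rule integral_Q_measurable[OF g]) measurable
  show "(\<lambda>k. jump_op g r (u k)) \<longlonglongrightarrow> jump_op g r y"
    unfolding jump_op_def
  proof (rule integral_dominated_convergence[where w = "\<lambda>s. indicator {0..r} s * L"])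
    have "(\<lambda>k. jump_density (u k) s * ?I (u k) s) \<longlonglongrightarrow> jump_density y s * ?I y s" if s: "0 \<le> s" "s \<le> r" for s
    proof -
      have cg: "continuous_on UNIV (g (r - s))" using g s by (simp add: admissible_def)
      have "bounded (range (g (r - s)))"
        using admissible_bounds[OF g] by (auto simp: bounded_iff intro!: exI[of _ 1])
      with cg have "g (r - s) \<in> bcontfun" by (simp add: bcontfun_def)
      note cQ = W8(3,4)[OF this]
      \<comment> \<open>The factor \<open>rate\<close> of the density absorbs the integral against
        \<open>Q\<close> into the mixture, leaving integrals against \<open>Qr\<close> and
        \<open>Qb\<close>, which \<open>W8\<close> shows to be continuous.\<close>
      have eq: "jump_density y s * ?I y s = exp (- cum_rate s y) *
          (rate_r (flow s y) * (\<integral>x. g (r - s) x \<partial>Qr (flow s y)) + rate_b (flow s y) * (\<integral>x. g (r - s) x \<partial>Qb (flow s y)))" for y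
        using Q_mixture_integral[OF admissible_section_measurable[OF g] admissible_bounds[OF g], of "flow s y" "r - s"] s
        by (simp add: jump_density_def ac_simps)
      have fl: "(\<lambda>k. F (flow s (u k))) \<longlonglongrightarrow> F (flow s y)" if "continuous_on UNIV F" for F :: "'z \<Rightarrow> real"
        by (rule continuous_on_tendsto_compose[OF that])
          (auto intro: continuous_on_tendsto_compose[OF flow_continuous_space u])
      show ?thesis unfolding eq
        by (intro tendsto_intros fl W8(1,2) cQ continuous_on_tendsto_compose[OF cum_rate_continuous u]) (use s in auto)
    qed
    then show "AE s in lborel. (\<lambda>k. indicator {0..r} s * (jump_density (u k) s * ?I (u k) s))
        \<longlonglongrightarrow> indicator {0..r} s * (jump_density y s * ?I y s)"
      by (intro AE_I2) (auto split: split_indicator)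
    have "jump_density (u k) s * ?I (u k) s \<le> L" if s: "0 \<le> s" "s \<le> r" for s k
    proof -
      have "rate (flow s (u k)) * exp (- cum_rate s (u k)) * ?I (u k) s \<le> L * 1 * 1"
        using L[OF s, of k] cum_rate_nonneg[of s "u k"] integral_Q_admissible(2,3)[OF g]
          rate_nonneg[of "flow s (u k)"]
        by (intro mult_mono) auto
      with s show ?thesis by (simp add: jump_density_def)
    qed
    then show "AE s in lborel. norm (indicator {0..r} s * (jump_density (u k) s * ?I (u k) s)) \<le> indicator {0..r} s * L" for k
      by (intro AE_I2) (auto simp: abs_mult jump_density_nonneg integral_Q_admissible(2)[OF g] split: split_indicator)
  qed (use borel_integrable_atLeastAtMost'[of 0 r "\<lambda>_. L"] in \<open>auto simp: set_integrable_def\<close>)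
qed

text \<open>This closure property lets the operator be iterated and makes every term of the series
  continuous in the starting point.\<close>

lemma jump_op_admissible:
  assumes g: "admissible g"
  shows "admissible (jump_op g)"
proof -
  have [measurable]: "(\<lambda>p. \<integral>x. g (fst (fst p) - snd p) x \<partial>Q (flow (snd p) (snd (fst p))))
      \<in> borel_measurable ((borel \<Otimes>\<^sub>M borel) \<Otimes>\<^sub>M borel)"
    by (rule integral_Q_measurable[OF g]) measurable
  have "(\<lambda>p. jump_op g (fst p) (snd p)) \<in> borel_measurable (borel \<Otimes>\<^sub>M borel)"
    unfolding jump_op_def indicator_def[of "{_.._}"] atLeastAtMost_iff
    by (rule lborel.borel_measurable_lebesgue_integral) (simp add: case_prod_unfold)
  then show ?thesis
    by (simp add: admissible_def jump_op_nn_integral(2,3)[OF g] jump_op_continuous[OF g])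
qed

lemma jump_op_power_admissible: "admissible g \<Longrightarrow> admissible ((jump_op ^^ n) g)"
  by (induction n) (auto intro: jump_op_admissible)

text \<open>The function \<open>g\<close> of the outline: the contribution to the expectation of
  \<open>f\<close> at time \<open>r\<close> from paths that have not jumped by then.\<close>

definition no_jump :: "('z \<Rightarrow> real) \<Rightarrow> real \<Rightarrow> 'z \<Rightarrow> real" where
  "no_jump f r y = f (flow r y) * exp (- cum_rate r y)"

lemma no_jump_admissible:
  assumes "continuous_on UNIV f" "\<And>x. 0 \<le> f x" "\<And>x. f x \<le> 1"
  shows "admissible (no_jump f)"
proof -
  have [measurable]: "f \<in> borel_measurable borel"
    using assms(1) by (rule borel_measurable_continuous_onI)
  have "no_jump f r y \<le> 1" for r y
    using mult_mono[OF assms(3), of "exp (- cum_rate r y)" 1] cum_rate_nonneg by (simp add: no_jump_def)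
  moreover have "continuous_on UNIV (no_jump f r)" if "r \<ge> 0" for r
    unfolding no_jump_def
    by (intro continuous_intros cum_rate_continuous that continuous_on_compose2[OF assms(1) flow_continuous_space]) simp
  ultimately show ?thesis
    using assms(2) by (simp add: admissible_def no_jump_def)
qed

end

subsection \<open>Removing the last jump\<close>

locale pdmp_W_process = pdmp_W X \<phi> rate_r rate_b Qr Qb Q
    + pdmp_from M \<phi> "\<lambda>y. rate_r y + rate_b y" Q z S Y Z
  for X :: "'z::banach \<Rightarrow> 'z" and \<phi> :: "real \<Rightarrow> 'z \<Rightarrow> 'z"
    and rate_r rate_b :: "'z \<Rightarrow> real" and Qr Qb Q :: "'z \<Rightarrow> 'z measure"
    and M :: "'w measure" and z :: 'z and S :: "nat \<Rightarrow> 'w \<Rightarrow> ennreal" and Y :: "nat \<Rightarrow> 'w \<Rightarrow> 'z"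
    and Z :: "real \<Rightarrow> 'w \<Rightarrow> 'z"
begin

declare S_measurable[measurable] Y_measurable[measurable]

abbreviation T :: "nat \<Rightarrow> 'w \<Rightarrow> ennreal" where "T \<equiv> jump_time S"
abbreviation history :: "nat \<Rightarrow> nat \<Rightarrow> 'w measure" where "history \<equiv> jump_history M S Y"

section \<open>Jump times and the histories they generate\<close>

lemma T_0: "T 0 \<omega> = 0" and T_Suc: "T (Suc n) \<omega> = T n \<omega> + S n \<omega>"
  by (simp_all add: jump_time_def)

lemma T_mono: "incseq (\<lambda>n. T n \<omega>)"
  by (rule incseq_SucI) (simp add: T_Suc)

lemma T_measurable[measurable]: "T n \<in> borel_measurable M"
  unfolding jump_time_def by measurable

lemma space_history: "space (history m n) = space M"
  by (simp add: jump_history_def space_measure_of_conv)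

lemma sets_history: "sets (history m n) = sigma_sets (space M)
     ({S k -` A \<inter> space M | k A. k < m \<and> A \<in> sets borel} \<union>
      {Y k -` A \<inter> space M | k A. k \<le> n \<and> A \<in> sets borel})"
  unfolding jump_history_def by (rule sets_measure_of) auto

lemma S_history: "k < m \<Longrightarrow> S k \<in> borel_measurable (history m n)"
  by (rule measurableI) (auto simp: sets_history space_history intro!: sigma_sets.Basic)

lemma Y_history: "k \<le> n \<Longrightarrow> Y k \<in> borel_measurable (history m n)"
  by (rule measurableI) (auto simp: sets_history space_history intro!: sigma_sets.Basic)

lemma T_history: "k \<le> m \<Longrightarrow> T k \<in> borel_measurable (history m n)"
  unfolding jump_time_def by (intro borel_measurable_sum S_history) auto

lemma history_subalgebra: "subalgebra M (history m n)"
  unfolding subalgebra_def space_history sets_history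
  by (auto intro!: sets.sigma_sets_subset)

text \<open>Since \<open>A\<close> lies in the history, integrating over it turns
  \<open>indicator B\<close> into its conditional expectation, and only the values on
  \<open>A\<close> enter. This fits the process, whose conditional laws are prescribed on the event
  that the jump time is finite.\<close>

lemma emeasure_cond_exp:
  assumes A: "A \<in> sets (history m n)" and B[measurable]: "B \<in> sets M"
    and \<rho>[measurable]: "\<rho> \<in> borel_measurable M" and \<rho>_bounds: "\<And>\<omega>. 0 \<le> \<rho> \<omega>" "\<And>\<omega>. \<rho> \<omega> \<le> 1"
    and eq: "AE \<omega> in M. \<omega> \<in> A \<longrightarrow> real_cond_exp M (history m n) (indicator B) \<omega> = \<rho> \<omega>"
  shows "emeasure M (A \<inter> B) = (\<integral>\<^sup>+\<omega>. indicator A \<omega> * ennreal (\<rho> \<omega>) \<partial>M)"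
proof -
  interpret finite_measure_subalgebra M "history m n"
    by unfold_locales (rule history_subalgebra)
  have [measurable]: "A \<in> sets M"
    using A history_subalgebra by (auto simp: subalgebra_def)
  have ind: "integrable M (indicator B :: 'w \<Rightarrow> real)"
    by (rule integrable_const_bound[where B = 1]) auto
  have "measure M (A \<inter> B) = (\<integral>\<omega>. indicator A \<omega> * indicator B \<omega> \<partial>M)"
    by (simp add: indicator_inter_arith[symmetric])
  also have "\<dots> = (\<integral>\<omega>. indicator A \<omega> * real_cond_exp M (history m n) (indicator B) \<omega> \<partial>M)"
    using real_cond_exp_intA[OF ind A] by (simp add: set_lebesgue_integral_def)
  also have "\<dots> = (\<integral>\<omega>. indicator A \<omega> * \<rho> \<omega> \<partial>M)"
    by (rule integral_cong_AE) (use eq in \<open>auto split: split_indicator\<close>)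
  finally have "emeasure M (A \<inter> B) = ennreal (\<integral>\<omega>. indicator A \<omega> * \<rho> \<omega> \<partial>M)"
    by (simp add: emeasure_eq_measure)
  also have "\<dots> = (\<integral>\<^sup>+\<omega>. ennreal (indicator A \<omega> * \<rho> \<omega>) \<partial>M)"
  proof (rule nn_integral_eq_integral[symmetric])
    show "integrable M (\<lambda>\<omega>. indicator A \<omega> * \<rho> \<omega>)"
      by (rule integrable_const_bound[where B = 1]) (use \<rho>_bounds in \<open>auto split: split_indicator\<close>)
  qed (use \<rho>_bounds in simp)
  also have "\<dots> = (\<integral>\<^sup>+\<omega>. indicator A \<omega> * ennreal (\<rho> \<omega>) \<partial>M)"
    by (rule nn_integral_cong) (auto split: split_indicator)
  finally show ?thesis .
qed

section \<open>Joint laws of waiting times and positions\<close>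

text \<open>The waiting time is prescribed through its survival probabilities, so the event that it
  is at most \<open>b\<close> is treated as the complement of \<open>B\<close> within
  \<open>A\<close>. The complement also discards infinite waiting times.\<close>

lemma waiting_time_rect:
  assumes C[measurable]: "C \<in> sets (borel \<Otimes>\<^sub>M borel)"
  shows "emeasure M {\<omega> \<in> space M. \<omega> \<in> {\<omega> \<in> space M. T n \<omega> < \<infinity> \<and> S n \<omega> < \<infinity>} \<and>
      (T n \<omega>, Y n \<omega>) \<in> C \<and> enn2real (S n \<omega>) \<in> {..b}}
    = (\<integral>\<^sup>+\<omega>. indicator {\<omega> \<in> space M. T n \<omega> < \<infinity>} \<omega> * (indicator C (T n \<omega>, Y n \<omega>) *
        emeasure (density lborel (\<lambda>s. ennreal (jump_density (Y n \<omega>) s))) {..b}) \<partial>M)"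
    (is "emeasure M ?E = ?rhs")
proof (cases "b \<ge> 0")
  \<comment> \<open>Both sides vanish: \<open>enn2real\<close> is nonnegative, and the density is
    zero at negative times.\<close>
  case False
  then have "\<not> enn2real x \<le> b" for x
    using enn2real_nonneg[of x] by linarith
  then have "?E = {}" by simp
  moreover have "emeasure (density lborel (\<lambda>s. ennreal (jump_density y s))) {..b} = 0" for y
    using False by (simp add: emeasure_density jump_density_atMost)
  ultimately show ?thesis by (simp only: mult_zero_left mult_zero_right emeasure_empty nn_integral_const)
next
  case True
  define A where "A = {\<omega> \<in> space M. T n \<omega> < \<infinity> \<and> (T n \<omega>, Y n \<omega>) \<in> C}"
  define B where "B = {\<omega> \<in> space M. S n \<omega> > ennreal b}"
  have [measurable]: "A \<in> sets M" "B \<in> sets M" unfolding A_def B_def by measurable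
  have "A \<in> sets (history n n)"
  proof -
    note [measurable] = T_history[OF order_refl, of n n] Y_history[OF order_refl, of n n]
    show ?thesis unfolding A_def space_history[of n n, symmetric] by measurable
  qed
  moreover have "AE \<omega> in M. \<omega> \<in> A \<longrightarrow> real_cond_exp M (history n n) (indicator B) \<omega> = exp (- cum_rate b (Y n \<omega>))"
    using waiting_time[OF True, of n] unfolding A_def B_def
    by eventually_elim (simp add: cum_rate_eq[OF True])
  ultimately have AB: "emeasure M (A \<inter> B) = (\<integral>\<^sup>+\<omega>. indicator A \<omega> * ennreal (exp (- cum_rate b (Y n \<omega>))) \<partial>M)"
    by (intro emeasure_cond_exp) (auto simp: cum_rate_nonneg)
  \<comment> \<open>\<open>enn2real\<close> sends \<open>\<infinity>\<close> to 0, so finiteness has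
    to be required separately; an infinite waiting time counts as exceeding
    \<open>b\<close>.\<close>
  have "x < \<infinity> \<and> enn2real x \<le> b \<longleftrightarrow> \<not> ennreal b < x" for x
    using True by (cases x) (auto simp: not_less top_unique)
  then have E: "?E = A - B"
    by (auto simp: A_def B_def)
  have rhs: "?rhs = (\<integral>\<^sup>+\<omega>. indicator A \<omega> * ennreal (1 - exp (- cum_rate b (Y n \<omega>))) \<partial>M)"
    using True by (intro nn_integral_cong) (auto simp: A_def emeasure_density jump_density_atMost split: split_indicator)
  \<comment> \<open>Adding the complementary event and cancelling its finite measure avoids
    subtraction in \<open>ennreal\<close>.\<close>
  have "emeasure M ?E + emeasure M (A \<inter> B) = emeasure M A"
    unfolding E by (subst plus_emeasure) (auto intro!: arg_cong[where f = "emeasure M"])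
  also have "\<dots> = (\<integral>\<^sup>+\<omega>. indicator A \<omega> \<partial>M)" by simp
  also have "\<dots> = (\<integral>\<^sup>+\<omega>. indicator A \<omega> * ennreal (1 - exp (- cum_rate b (Y n \<omega>)))
      + indicator A \<omega> * ennreal (exp (- cum_rate b (Y n \<omega>))) \<partial>M)"
    by (rule nn_integral_cong)
      (auto simp: ennreal_plus[symmetric] cum_rate_nonneg simp del: ennreal_plus split: split_indicator)
  also have "\<dots> = ?rhs + emeasure M (A \<inter> B)"
    unfolding rhs AB by (rule nn_integral_add) measurable
  finally show ?thesis
    by (simp add: ennreal_add_left_cancel add.commute[of _ "emeasure M (A \<inter> B)"] emeasure_eq_measure)
qed

text \<open>Half-lines generate the Borel sets and are stable under intersections, so the rectangle
  identity suffices. Finiteness of \<open>S n\<close> is required on the left because the density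
  describes finite waiting times; its missing mass belongs to paths that never jump again.\<close>

lemma waiting_time_disintegration:
  assumes h[measurable]: "h \<in> borel_measurable ((borel \<Otimes>\<^sub>M borel) \<Otimes>\<^sub>M borel)"
  shows "(\<integral>\<^sup>+\<omega>. indicator {\<omega> \<in> space M. T n \<omega> < \<infinity> \<and> S n \<omega> < \<infinity>} \<omega>
        * h ((T n \<omega>, Y n \<omega>), enn2real (S n \<omega>)) \<partial>M)
    = (\<integral>\<^sup>+\<omega>. indicator {\<omega> \<in> space M. T n \<omega> < \<infinity>} \<omega>
        * (\<integral>\<^sup>+s. ennreal (jump_density (Y n \<omega>) s) * h ((T n \<omega>, Y n \<omega>), s) \<partial>lborel) \<partial>M)"
proof -
  let ?k = "\<lambda>p :: ennreal \<times> 'z. density lborel (\<lambda>s. ennreal (jump_density (snd p) s))"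
  have "(\<integral>\<^sup>+\<omega>. indicator {\<omega> \<in> space M. T n \<omega> < \<infinity> \<and> S n \<omega> < \<infinity>} \<omega>
        * h ((T n \<omega>, Y n \<omega>), enn2real (S n \<omega>)) \<partial>M)
    = (\<integral>\<^sup>+\<omega>. indicator {\<omega> \<in> space M. T n \<omega> < \<infinity>} \<omega>
        * (\<integral>\<^sup>+s. h ((T n \<omega>, Y n \<omega>), s) \<partial>?k (T n \<omega>, Y n \<omega>)) \<partial>M)"
  proof (rule nn_integral_disintegration[where G = "range (\<lambda>a :: real. {..a})" and A = "\<lambda>i. {..real i}"
        and E = "borel \<Otimes>\<^sub>M borel" and N = borel and D = "\<lambda>\<omega>. (T n \<omega>, Y n \<omega>)" and \<kappa> = ?k])
    show "prob_space M" by unfold_locales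
    show "?k \<in> borel \<Otimes>\<^sub>M borel \<rightarrow>\<^sub>M subprob_algebra borel"
      by (rule measurable_compose[OF measurable_snd jump_density_kernel])
    show "Int_stable (range (\<lambda>a :: real. {..a}))"
      by (auto simp: Int_stable_def)
    show "sets borel = sigma_sets (space borel) (range (\<lambda>a :: real. {..a}))"
      by (subst borel_eq_atMost) simp
    show "(\<Union>i::nat. {..real i}) = space borel"
      using real_arch_simple by auto
    fix C :: "(ennreal \<times> 'z) set" and B :: "real set" assume "C \<in> sets (borel \<Otimes>\<^sub>M borel)" "B \<in> range (\<lambda>a :: real. {..a})"
    then show "emeasure M {\<omega> \<in> space M. \<omega> \<in> {\<omega> \<in> space M. T n \<omega> < \<infinity> \<and> S n \<omega> < \<infinity>} \<and>
          (T n \<omega>, Y n \<omega>) \<in> C \<and> enn2real (S n \<omega>) \<in> B}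
        = (\<integral>\<^sup>+\<omega>. indicator {\<omega> \<in> space M. T n \<omega> < \<infinity>} \<omega> * (indicator C (T n \<omega>, Y n \<omega>) *
            emeasure (?k (T n \<omega>, Y n \<omega>)) B) \<partial>M)"
      using waiting_time_rect by auto
  qed (auto simp: h)
  also have "\<dots> = (\<integral>\<^sup>+\<omega>. indicator {\<omega> \<in> space M. T n \<omega> < \<infinity>} \<omega>
        * (\<integral>\<^sup>+s. ennreal (jump_density (Y n \<omega>) s) * h ((T n \<omega>, Y n \<omega>), s) \<partial>lborel) \<partial>M)"
    by (simp add: nn_integral_density)
  finally show ?thesis .
qed

text \<open>Here the kernel has mass 1 and both sides live on the same event. \<open>S n\<close> and
  \<open>Y n\<close> determine the position just before the jump; \<open>T (Suc n)\<close> is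
  carried along for the test function.\<close>

lemma jump_disintegration:
  assumes h[measurable]: "h \<in> borel_measurable (((borel \<Otimes>\<^sub>M borel) \<Otimes>\<^sub>M borel) \<Otimes>\<^sub>M borel)"
  shows "(\<integral>\<^sup>+\<omega>. indicator {\<omega> \<in> space M. T (Suc n) \<omega> < \<infinity>} \<omega>
        * h (((S n \<omega>, Y n \<omega>), T (Suc n) \<omega>), Y (Suc n) \<omega>) \<partial>M)
    = (\<integral>\<^sup>+\<omega>. indicator {\<omega> \<in> space M. T (Suc n) \<omega> < \<infinity>} \<omega>
        * (\<integral>\<^sup>+v. h (((S n \<omega>, Y n \<omega>), T (Suc n) \<omega>), v) \<partial>Q (flow (enn2real (S n \<omega>)) (Y n \<omega>))) \<partial>M)"
proof -
  let ?D = "\<lambda>\<omega>. ((S n \<omega>, Y n \<omega>), T (Suc n) \<omega>)"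
  let ?k = "\<lambda>p :: (ennreal \<times> 'z) \<times> ennreal. Q (flow (enn2real (fst (fst p))) (snd (fst p)))"
  have "(\<integral>\<^sup>+\<omega>. indicator {\<omega> \<in> space M. T (Suc n) \<omega> < \<infinity>} \<omega> * h (?D \<omega>, Y (Suc n) \<omega>) \<partial>M)
    = (\<integral>\<^sup>+\<omega>. indicator {\<omega> \<in> space M. T (Suc n) \<omega> < \<infinity>} \<omega> * (\<integral>\<^sup>+v. h (?D \<omega>, v) \<partial>?k (?D \<omega>)) \<partial>M)"
  proof (rule nn_integral_disintegration[where G = "sets borel" and A = "\<lambda>i. UNIV"
        and E = "(borel \<Otimes>\<^sub>M borel) \<Otimes>\<^sub>M borel" and N = borel and D = ?D and \<kappa> = ?k])
    show "prob_space M" by unfold_locales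
    show "?k \<in> (borel \<Otimes>\<^sub>M borel) \<Otimes>\<^sub>M borel \<rightarrow>\<^sub>M subprob_algebra borel"
      by (rule measurable_compose[OF _ measurable_prob_algebraD[OF Q_kernel]]) measurable
    show "Int_stable (sets borel)" by (auto simp: Int_stable_def)
    show "sets borel = sigma_sets (space borel) (sets borel)" by (rule sets.sigma_sets_eq[symmetric])
    fix C :: "((ennreal \<times> 'z) \<times> ennreal) set" and B :: "'z set" assume C[measurable]: "C \<in> sets ((borel \<Otimes>\<^sub>M borel) \<Otimes>\<^sub>M borel)" and B[measurable]: "B \<in> sets borel"
    define A where "A = {\<omega> \<in> space M. T (Suc n) \<omega> < \<infinity> \<and> ?D \<omega> \<in> C}"
    \<comment> \<open>The first index counts the waiting times \<open>S 0\<close> to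
      \<open>S n\<close>, the second is the last known position \<open>Y n\<close>; thus
      \<open>T (Suc n)\<close> is known while \<open>Y (Suc n)\<close> is still to be drawn.\<close>
    have "A \<in> sets (history (Suc n) n)"
    proof -
      note [measurable] = T_history[OF order_refl, of "Suc n" n] Y_history[OF order_refl, of n "Suc n"]
        S_history[OF lessI, of n n]
      show ?thesis unfolding A_def space_history[of "Suc n" n, symmetric] by measurable
    qed
    moreover have "AE \<omega> in M. \<omega> \<in> A \<longrightarrow>
        real_cond_exp M (history (Suc n) n) (indicator {\<omega> \<in> space M. Y (Suc n) \<omega> \<in> B}) \<omega>
          = measure (Q (flow (enn2real (S n \<omega>)) (Y n \<omega>))) B"
      using jump[OF B, of n] unfolding A_def by eventually_elim (simp add: flow_def)
    moreover have "(\<lambda>\<omega>. measure (Q (flow (enn2real (S n \<omega>)) (Y n \<omega>))) B) \<in> borel_measurable M"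
    proof -
      have "(\<lambda>\<omega>. Q (flow (enn2real (S n \<omega>)) (Y n \<omega>))) \<in> M \<rightarrow>\<^sub>M subprob_algebra borel"
        by (rule measurable_compose[OF _ measurable_prob_algebraD[OF Q_kernel]]) measurable
      then show ?thesis by (rule measurable_compose[OF _ measurable_measure_subprob_algebra[OF B]])
    qed
    ultimately have "emeasure M (A \<inter> {\<omega> \<in> space M. Y (Suc n) \<omega> \<in> B})
        = (\<integral>\<^sup>+\<omega>. indicator A \<omega> * ennreal (measure (Q (flow (enn2real (S n \<omega>)) (Y n \<omega>))) B) \<partial>M)"
      by (intro emeasure_cond_exp) (auto intro: prob_space.prob_le_1 prob_kernel[OF Q_kernel])
    also have "\<dots> = (\<integral>\<^sup>+\<omega>. indicator {\<omega> \<in> space M. T (Suc n) \<omega> < \<infinity>} \<omega> * (indicator C (?D \<omega>) * emeasure (?k (?D \<omega>)) B) \<partial>M)"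
      by (intro nn_integral_cong)
        (auto simp: A_def finite_measure.emeasure_eq_measure[OF prob_space.finite_measure[OF prob_kernel(1)[OF Q_kernel]]]
          split: split_indicator)
    also have "A \<inter> {\<omega> \<in> space M. Y (Suc n) \<omega> \<in> B}
        = {\<omega> \<in> space M. \<omega> \<in> {\<omega> \<in> space M. T (Suc n) \<omega> < \<infinity>} \<and> ?D \<omega> \<in> C \<and> Y (Suc n) \<omega> \<in> B}"
      by (auto simp: A_def)
    finally show "emeasure M {\<omega> \<in> space M. \<omega> \<in> {\<omega> \<in> space M. T (Suc n) \<omega> < \<infinity>} \<and> ?D \<omega> \<in> C \<and> Y (Suc n) \<omega> \<in> B}
        = (\<integral>\<^sup>+\<omega>. indicator {\<omega> \<in> space M. T (Suc n) \<omega> < \<infinity>} \<omega> * (indicator C (?D \<omega>) * emeasure (?k (?D \<omega>)) B) \<partial>M)" .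
  qed (auto simp: h)
  then show ?thesis by simp
qed

section \<open>Trading the last jump for one application of the jump operator\<close>

definition post_jump :: "real \<Rightarrow> nat \<Rightarrow> (real \<Rightarrow> 'z \<Rightarrow> real) \<Rightarrow> ennreal" where
  "post_jump t n g =
    (\<integral>\<^sup>+\<omega>. indicator {..ennreal t} (T n \<omega>) * ennreal (g (t - enn2real (T n \<omega>)) (Y n \<omega>)) \<partial>M)"

text \<open>The tower property in two stages: \<open>Y (Suc n)\<close> is integrated out given the
  history through \<open>S n\<close>, then \<open>S n\<close> given the history at the n-th jump.
  What remains is \<open>jump_op g\<close> at the time left after that jump.\<close>

lemma post_jump_Suc:
  assumes g: "admissible g" and "t \<ge> 0"
  shows "post_jump t (Suc n) g = post_jump t n (jump_op g)"
proof -
  \<comment> \<open>\<open>h1\<close> is the integrand before the new position is integrated out,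
    \<open>h2\<close> the one afterwards, with the new jump time written as \<open>T n\<close> plus
    the waiting time.\<close>
  define h1 where "h1 = (\<lambda>p :: ((ennreal \<times> 'z) \<times> ennreal) \<times> 'z.
    indicator {..ennreal t} (snd (fst p)) * ennreal (g (t - enn2real (snd (fst p))) (snd p)))"
  define h2 where "h2 = (\<lambda>p :: (ennreal \<times> 'z) \<times> real.
    indicator {..ennreal t} (fst (fst p) + ennreal (snd p)) *
      (\<integral>\<^sup>+v. ennreal (g (t - enn2real (fst (fst p)) - snd p) v) \<partial>Q (flow (snd p) (snd (fst p)))))"
  have h1: "h1 \<in> borel_measurable (((borel \<Otimes>\<^sub>M borel) \<Otimes>\<^sub>M borel) \<Otimes>\<^sub>M borel)"
  proof -
    have [measurable]: "(\<lambda>p :: ((ennreal \<times> 'z) \<times> ennreal) \<times> 'z. g (t - enn2real (snd (fst p))) (snd p))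
        \<in> borel_measurable (((borel \<Otimes>\<^sub>M borel) \<Otimes>\<^sub>M borel) \<Otimes>\<^sub>M borel)"
      by (rule admissible_measurable[OF g]) measurable
    show ?thesis unfolding h1_def by measurable
  qed
  have h2: "h2 \<in> borel_measurable ((borel \<Otimes>\<^sub>M borel) \<Otimes>\<^sub>M borel)"
  proof -
    have [measurable]: "(\<lambda>p :: (ennreal \<times> 'z) \<times> real.
        \<integral>\<^sup>+v. ennreal (g (t - enn2real (fst (fst p)) - snd p) v) \<partial>Q (flow (snd p) (snd (fst p))))
        \<in> borel_measurable ((borel \<Otimes>\<^sub>M borel) \<Otimes>\<^sub>M borel)"
      by (rule nn_integral_Q_measurable[OF g]) measurable
    show ?thesis unfolding h2_def by measurable
  qed
  have "post_jump t (Suc n) g = (\<integral>\<^sup>+\<omega>. indicator {\<omega> \<in> space M. T (Suc n) \<omega> < \<infinity>} \<omega>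
        * h1 (((S n \<omega>, Y n \<omega>), T (Suc n) \<omega>), Y (Suc n) \<omega>) \<partial>M)"
    unfolding post_jump_def h1_def
    by (rule nn_integral_cong) (auto simp: less_top[symmetric] top_unique split: split_indicator)
  also have "\<dots> = (\<integral>\<^sup>+\<omega>. indicator {\<omega> \<in> space M. T (Suc n) \<omega> < \<infinity>} \<omega>
        * (\<integral>\<^sup>+v. h1 (((S n \<omega>, Y n \<omega>), T (Suc n) \<omega>), v) \<partial>Q (flow (enn2real (S n \<omega>)) (Y n \<omega>))) \<partial>M)"
    by (rule jump_disintegration[OF h1])
  also have "\<dots> = (\<integral>\<^sup>+\<omega>. indicator {\<omega> \<in> space M. T n \<omega> < \<infinity> \<and> S n \<omega> < \<infinity>} \<omega>
        * h2 ((T n \<omega>, Y n \<omega>), enn2real (S n \<omega>)) \<partial>M)"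
  proof (rule nn_integral_cong)
    fix \<omega> assume "\<omega> \<in> space M"
    show "indicator {\<omega> \<in> space M. T (Suc n) \<omega> < \<infinity>} \<omega>
        * (\<integral>\<^sup>+v. h1 (((S n \<omega>, Y n \<omega>), T (Suc n) \<omega>), v) \<partial>Q (flow (enn2real (S n \<omega>)) (Y n \<omega>)))
      = indicator {\<omega> \<in> space M. T n \<omega> < \<infinity> \<and> S n \<omega> < \<infinity>} \<omega> * h2 ((T n \<omega>, Y n \<omega>), enn2real (S n \<omega>))"
    proof (cases "T n \<omega> < \<infinity> \<and> S n \<omega> < \<infinity>")
      case True
      \<comment> \<open>Additivity of \<open>enn2real\<close> requires both summands to be finite,
        which is the case at hand.\<close>
      then have "enn2real (T (Suc n) \<omega>) = enn2real (T n \<omega>) + enn2real (S n \<omega>)" "ennreal (enn2real (S n \<omega>)) = S n \<omega>"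
        by (auto simp: T_Suc enn2real_plus)
      with True show ?thesis
        by (auto simp: h1_def h2_def T_Suc diff_diff_eq nn_integral_cmult split: split_indicator)
    qed (auto simp: T_Suc less_top[symmetric])
  qed
  also have "\<dots> = (\<integral>\<^sup>+\<omega>. indicator {\<omega> \<in> space M. T n \<omega> < \<infinity>} \<omega>
        * (\<integral>\<^sup>+s. ennreal (jump_density (Y n \<omega>) s) * h2 ((T n \<omega>, Y n \<omega>), s) \<partial>lborel) \<partial>M)"
    by (rule waiting_time_disintegration[OF h2])
  also have "\<dots> = post_jump t n (jump_op g)"
    unfolding post_jump_def
  proof (rule nn_integral_cong)
    fix \<omega> assume "\<omega> \<in> space M"
    show "indicator {\<omega> \<in> space M. T n \<omega> < \<infinity>} \<omega>
        * (\<integral>\<^sup>+s. ennreal (jump_density (Y n \<omega>) s) * h2 ((T n \<omega>, Y n \<omega>), s) \<partial>lborel)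
      = indicator {..ennreal t} (T n \<omega>) * ennreal (jump_op g (t - enn2real (T n \<omega>)) (Y n \<omega>))"
    proof (cases "T n \<omega>")
      case (real \<tau>)
      \<comment> \<open>Negative \<open>s\<close> contribute nothing because the density vanishes
        there. For \<open>s \<ge> 0\<close> the condition \<open>\<tau> + s \<le> t\<close> amounts
        to \<open>\<tau> \<le> t\<close> together with \<open>s \<le> t - \<tau>\<close>.\<close>
      have "ennreal (jump_density (Y n \<omega>) s) * h2 ((T n \<omega>, Y n \<omega>), s)
        = indicator {..ennreal t} (T n \<omega>) * (ennreal (jump_density (Y n \<omega>) s) *
            (indicator {0..t - \<tau>} s * (\<integral>\<^sup>+v. ennreal (g (t - \<tau> - s) v) \<partial>Q (flow s (Y n \<omega>)))))" for s
        using real \<open>t \<ge> 0\<close>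
        by (cases "s \<ge> 0")
          (auto simp: h2_def jump_density_def ennreal_plus[symmetric] simp del: ennreal_plus split: split_indicator)
      moreover have "(\<lambda>s. ennreal (jump_density (Y n \<omega>) s) *
            (indicator {0..t - \<tau>} s * (\<integral>\<^sup>+v. ennreal (g (t - \<tau> - s) v) \<partial>Q (flow s (Y n \<omega>))))) \<in> borel_measurable borel"
      proof -
        have [measurable]: "(\<lambda>s. \<integral>\<^sup>+v. ennreal (g (t - \<tau> - s) v) \<partial>Q (flow s (Y n \<omega>))) \<in> borel_measurable borel"
          by (rule nn_integral_Q_measurable[OF g]) measurable
        show ?thesis by measurable
      qed
      ultimately show ?thesis
        using real \<open>\<omega> \<in> space M\<close> by (simp add: nn_integral_cmult jump_op_nn_integral(1)[OF g])
    qed (simp add: top_unique)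
  qed
  finally show ?thesis .
qed

lemma post_jump_0:
  assumes "t \<ge> 0"
  shows "post_jump t 0 g = ennreal (g t z)"
proof -
  have "post_jump t 0 g = (\<integral>\<^sup>+\<omega>. ennreal (g t z) \<partial>M)"
    unfolding post_jump_def by (rule nn_integral_cong_AE) (use initial in eventually_elim, simp add: T_0)
  then show ?thesis by (simp add: emeasure_space_1)
qed

text \<open>Induction with \<open>g\<close> arbitrary: removing the last jump replaces
  \<open>g\<close> by \<open>jump_op g\<close>, to which the induction hypothesis applies. With no
  jumps left, the starting point is almost surely \<open>z\<close>.\<close>

lemma post_jump_eq:
  assumes "admissible g" "t \<ge> 0"
  shows "post_jump t n g = ennreal ((jump_op ^^ n) g t z)"
  using \<open>admissible g\<close>
proof (induction n arbitrary: g)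
  case 0
  with assms show ?case by (simp add: post_jump_0)
next
  case (Suc n)
  have "post_jump t (Suc n) g = ennreal ((jump_op ^^ n) (jump_op g) t z)"
    using Suc.IH[OF jump_op_admissible[OF Suc.prems]] post_jump_Suc[OF Suc.prems \<open>t \<ge> 0\<close>] by simp
  then show ?case by (simp add: funpow_swap1)
qed

text \<open>Between the two jumps the path follows the flow, so \<open>f (Z t \<omega>)\<close>
  becomes a function \<open>c\<close> of \<open>(T n \<omega>, Y n \<omega>)\<close>. The part with
  \<open>T (Suc n) \<omega> \<le> t\<close> comes from the waiting time law; removing it from the
  whole leaves the survival factor of \<open>no_jump\<close>.\<close>

lemma post_jump_no_jump:
  assumes cont: "continuous_on UNIV f" and f: "\<And>x. 0 \<le> f x" "\<And>x. f x \<le> 1" and "t \<ge> 0"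
  shows "(\<integral>\<^sup>+\<omega>. (if T n \<omega> \<le> ennreal t \<and> ennreal t < T (Suc n) \<omega> then ennreal (f (Z t \<omega>)) else 0) \<partial>M)
    = post_jump t n (no_jump f)"
proof -
  have [measurable]: "f \<in> borel_measurable borel"
    using cont by (rule borel_measurable_continuous_onI)
  define c where "c = (\<lambda>p :: ennreal \<times> 'z. indicator {..ennreal t} (fst p) * ennreal (f (flow (t - enn2real (fst p)) (snd p))))"
  have [measurable]: "c \<in> borel_measurable (borel \<Otimes>\<^sub>M borel)" unfolding c_def by measurable
  let ?c = "\<lambda>\<omega>. c (T n \<omega>, Y n \<omega>)"
  let ?late = "\<integral>\<^sup>+\<omega>. ?c \<omega> * indicator {..ennreal t} (T (Suc n) \<omega>) \<partial>M"
  have c_le: "?c \<omega> \<le> 1" for \<omega>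
    using f by (auto simp: c_def split: split_indicator)
  have "?late = (\<integral>\<^sup>+\<omega>. indicator {\<omega> \<in> space M. T n \<omega> < \<infinity> \<and> S n \<omega> < \<infinity>} \<omega>
        * (\<lambda>p. c (fst p) * indicator {..ennreal t} (fst (fst p) + ennreal (snd p))) ((T n \<omega>, Y n \<omega>), enn2real (S n \<omega>)) \<partial>M)"
    by (rule nn_integral_cong) (auto simp: T_Suc less_top[symmetric] top_unique split: split_indicator)
  also have "\<dots> = (\<integral>\<^sup>+\<omega>. indicator {\<omega> \<in> space M. T n \<omega> < \<infinity>} \<omega>
        * (\<integral>\<^sup>+s. ennreal (jump_density (Y n \<omega>) s) *
            (\<lambda>p. c (fst p) * indicator {..ennreal t} (fst (fst p) + ennreal (snd p))) ((T n \<omega>, Y n \<omega>), s) \<partial>lborel) \<partial>M)"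
    by (rule waiting_time_disintegration) measurable
  also have "\<dots> = (\<integral>\<^sup>+\<omega>. ?c \<omega> * ennreal (1 - exp (- cum_rate (t - enn2real (T n \<omega>)) (Y n \<omega>))) \<partial>M)"
  proof (rule nn_integral_cong)
    fix \<omega> assume "\<omega> \<in> space M"
    show "indicator {\<omega> \<in> space M. T n \<omega> < \<infinity>} \<omega>
        * (\<integral>\<^sup>+s. ennreal (jump_density (Y n \<omega>) s) *
            (\<lambda>p. c (fst p) * indicator {..ennreal t} (fst (fst p) + ennreal (snd p))) ((T n \<omega>, Y n \<omega>), s) \<partial>lborel)
      = ?c \<omega> * ennreal (1 - exp (- cum_rate (t - enn2real (T n \<omega>)) (Y n \<omega>)))"
    proof (cases "T n \<omega> \<le> ennreal t")
      case True
      then obtain \<tau> where \<tau>: "T n \<omega> = ennreal \<tau>" "0 \<le> \<tau>" "\<tau> \<le> t"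
        using \<open>t \<ge> 0\<close> by (cases "T n \<omega>") (auto simp: top_unique)
      \<comment> \<open>The half-line has no lower end because the density is zero for negative
        \<open>s\<close>; this is the shape that \<open>jump_density_atMost\<close>
        evaluates.\<close>
      have "ennreal (jump_density (Y n \<omega>) s) * (c (T n \<omega>, Y n \<omega>) * indicator {..ennreal t} (T n \<omega> + ennreal s))
          = ?c \<omega> * (ennreal (jump_density (Y n \<omega>) s) * indicator {..t - \<tau>} s)" for s
        using \<tau> \<open>t \<ge> 0\<close>
        by (cases "s \<ge> 0")
          (auto simp: jump_density_def ennreal_plus[symmetric] mult.commute simp del: ennreal_plus split: split_indicator)
      then show ?thesis
        using \<tau> \<open>\<omega> \<in> space M\<close> by (simp add: nn_integral_cmult jump_density_atMost)
    qed (simp add: c_def)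
  qed
  finally have late: "?late = (\<integral>\<^sup>+\<omega>. ?c \<omega> * ennreal (1 - exp (- cum_rate (t - enn2real (T n \<omega>)) (Y n \<omega>))) \<partial>M)" .
  have before: "(\<integral>\<^sup>+\<omega>. (if T n \<omega> \<le> ennreal t \<and> ennreal t < T (Suc n) \<omega> then ennreal (f (Z t \<omega>)) else 0) \<partial>M)
      = (\<integral>\<^sup>+\<omega>. ?c \<omega> * indicator {ennreal t<..} (T (Suc n) \<omega>) \<partial>M)"
  proof (rule nn_integral_cong_AE, use path in eventually_elim)
    fix \<omega> assume *: "\<forall>n. \<forall>t\<ge>0. T n \<omega> \<le> ennreal t \<and> ennreal t < T (Suc n) \<omega> \<longrightarrow>
        Z t \<omega> = \<phi> (t - enn2real (T n \<omega>)) (Y n \<omega>)"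
    have "flow (t - enn2real (T n \<omega>)) = \<phi> (t - enn2real (T n \<omega>))" if "T n \<omega> \<le> ennreal t"
      using enn2real_leI[OF \<open>t \<ge> 0\<close> that] by (simp add: flow_def)
    with *[rule_format, OF \<open>t \<ge> 0\<close>, of n]
    show "(if T n \<omega> \<le> ennreal t \<and> ennreal t < T (Suc n) \<omega> then ennreal (f (Z t \<omega>)) else 0)
        = ?c \<omega> * indicator {ennreal t<..} (T (Suc n) \<omega>)"
      by (auto simp: c_def split: split_indicator)
  qed
  have total: "?late + (\<integral>\<^sup>+\<omega>. ?c \<omega> * indicator {ennreal t<..} (T (Suc n) \<omega>) \<partial>M) = (\<integral>\<^sup>+\<omega>. ?c \<omega> \<partial>M)"
    by (subst nn_integral_add[symmetric]) (auto intro!: nn_integral_cong split: split_indicator)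
  have "?late + post_jump t n (no_jump f) = (\<integral>\<^sup>+\<omega>. ?c \<omega> \<partial>M)"
  proof -
    have survive: "post_jump t n (no_jump f)
        = (\<integral>\<^sup>+\<omega>. ?c \<omega> * ennreal (exp (- cum_rate (t - enn2real (T n \<omega>)) (Y n \<omega>))) \<partial>M)"
      unfolding post_jump_def no_jump_def c_def
      by (rule nn_integral_cong) (simp add: ennreal_mult f mult.assoc)
    show ?thesis unfolding late survive
      by (subst nn_integral_add[symmetric])
        (auto intro!: nn_integral_cong simp: distrib_left[symmetric] ennreal_plus[symmetric] cum_rate_nonneg simp del: ennreal_plus)
  qed
  \<comment> \<open>The expectation of \<open>?c\<close> has been decomposed twice with the same
    summand \<open>?late\<close>, which is finite because \<open>c\<close> is at most 1 and can
    therefore be cancelled.\<close>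
  note total[folded this, unfolded ennreal_add_left_cancel]
  moreover have "?late \<noteq> \<infinity>"
  proof -
    have "?late \<le> (\<integral>\<^sup>+\<omega>. 1 \<partial>M)"
      using c_le by (intro nn_integral_mono) (auto split: split_indicator)
    then show ?thesis by (auto simp: emeasure_space_1 top_unique)
  qed
  ultimately show ?thesis by (simp add: before)
qed

section \<open>Summation over the number of jumps\<close>

text \<open>Non-explosion provides jump times beyond \<open>t\<close>. The predecessor of the first
  such index counts the jumps up to \<open>t\<close>, and monotonicity of the jump times makes it
  unique.\<close>

lemma AE_unique_interval:
  "AE \<omega> in M. \<exists>n. \<forall>k. (T k \<omega> \<le> ennreal t \<and> ennreal t < T (Suc k) \<omega>) \<longleftrightarrow> k = n"
  using non_explosive
proof eventually_elim
  fix \<omega> assume "(\<lambda>n. T n \<omega>) \<longlonglongrightarrow> \<infinity>"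
  then have "\<forall>\<^sub>F n in sequentially. ennreal t < T n \<omega>"
    by (rule order_tendstoD) simp
  then obtain m where "ennreal t < T m \<omega>" by (auto simp: eventually_sequentially)
  define l where "l = (LEAST m. ennreal t < T m \<omega>)"
  have l: "ennreal t < T l \<omega>" unfolding l_def by (rule LeastI) fact
  \<comment> \<open>\<open>l\<close> is positive because \<open>T 0 \<omega> = 0\<close> never
    exceeds \<open>ennreal t\<close>, even for negative \<open>t\<close>.\<close>
  then obtain n where n: "l = Suc n" by (cases l) (auto simp: T_0)
  have below: "T k \<omega> \<le> ennreal t" if "k < l" for k
    using not_less_Least[of k "\<lambda>m. ennreal t < T m \<omega>"] that by (simp add: l_def not_less)
  have "k = n" if "T k \<omega> \<le> ennreal t" "ennreal t < T (Suc k) \<omega>" for k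
  proof (rule antisym)
    show "k \<le> n"
      using incseqD[OF T_mono, of "Suc n" k \<omega>] l that(1) unfolding n by (meson leD not_less_eq_eq order_trans)
    show "n \<le> k"
      using below[of "Suc k"] that(2) unfolding n by (meson leD not_less_eq_eq Suc_less_eq not_le)
  qed
  with l below show "\<exists>n. \<forall>k. (T k \<omega> \<le> ennreal t \<and> ennreal t < T (Suc k) \<omega>) \<longleftrightarrow> k = n"
    by (intro exI[of _ n]) (auto simp: n)
qed

text \<open>At time \<open>t\<close> almost every path lies in exactly one inter-jump interval, so
  \<open>f (Z t \<omega>)\<close> is a sum with a single possibly nonzero term; nonnegativity allows
  sum and integral to be exchanged.\<close>

lemma expectation_sums:
  assumes cont: "continuous_on UNIV f" and f: "\<And>x. 0 \<le> f x" "\<And>x. f x \<le> 1" and "t \<ge> 0"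
  shows "(\<lambda>n. (jump_op ^^ n) (no_jump f) t z) sums (\<integral>\<omega>. f (Z t \<omega>) \<partial>M)"
proof -
  note [measurable] = Z_measurable[OF \<open>t \<ge> 0\<close>] borel_measurable_continuous_onI[OF cont]
  let ?p = "\<lambda>n \<omega>. if T n \<omega> \<le> ennreal t \<and> ennreal t < T (Suc n) \<omega> then ennreal (f (Z t \<omega>)) else 0"
  let ?w = "\<lambda>n. (jump_op ^^ n) (no_jump f) t z"
  have adm: "admissible (no_jump f)" by (rule no_jump_admissible[OF cont f])
  have w: "?w n \<ge> 0" for n
    by (rule admissible_bounds[OF jump_op_power_admissible[OF adm]])
  have "integrable M (\<lambda>\<omega>. f (Z t \<omega>))"
    by (rule integrable_const_bound[where B = 1]) (use f in auto)
  then have "ennreal (\<integral>\<omega>. f (Z t \<omega>) \<partial>M) = (\<integral>\<^sup>+\<omega>. ennreal (f (Z t \<omega>)) \<partial>M)"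
    by (rule nn_integral_eq_integral[symmetric]) (simp add: f)
  also have "\<dots> = (\<integral>\<^sup>+\<omega>. (\<Sum>n. ?p n \<omega>) \<partial>M)"
  proof (rule nn_integral_cong_AE, use AE_unique_interval[of t] in eventually_elim)
    fix \<omega> assume "\<exists>n. \<forall>k. (T k \<omega> \<le> ennreal t \<and> ennreal t < T (Suc k) \<omega>) \<longleftrightarrow> k = n"
    then obtain n where n: "\<And>k. (T k \<omega> \<le> ennreal t \<and> ennreal t < T (Suc k) \<omega>) \<longleftrightarrow> k = n" by blast
    have "(\<Sum>k. ?p k \<omega>) = (\<Sum>k\<in>{n}. ?p k \<omega>)"
      by (rule suminf_finite) (auto simp: n)
    then show "ennreal (f (Z t \<omega>)) = (\<Sum>k. ?p k \<omega>)" by (simp add: n)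
  qed
  also have "\<dots> = (\<Sum>n. \<integral>\<^sup>+\<omega>. ?p n \<omega> \<partial>M)"
    by (rule nn_integral_suminf) measurable
  also have "\<dots> = (\<Sum>n. ennreal (?w n))"
    by (simp add: post_jump_no_jump[OF cont f \<open>t \<ge> 0\<close>] post_jump_eq[OF adm \<open>t \<ge> 0\<close>])
  finally have "(\<lambda>n. ennreal (?w n)) sums ennreal (\<integral>\<omega>. f (Z t \<omega>) \<partial>M)"
    by (simp add: summable_sums)
  then show ?thesis
    unfolding sums_def by (subst (asm) sum_ennreal) (auto simp: w f sum_nonneg intro!: tendsto_ennreal_iff[THEN iffD1])
qed

end

subsection \<open>The Feller property\<close>

text \<open>Lower semicontinuity of a supremum of continuous functions: some partial sum exceeds
  \<open>a\<close> at \<open>x\<close>, hence near \<open>x\<close>, and partial sums of nonnegative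
  terms stay below \<open>u\<close>.\<close>

lemma sums_nonneg_eventually_gt:
  fixes w :: "nat \<Rightarrow> 'a::topological_space \<Rightarrow> real"
  assumes cont: "\<And>n. continuous_on UNIV (w n)" and nonneg: "\<And>n y. 0 \<le> w n y"
    and sums: "\<And>y. (\<lambda>n. w n y) sums u y" and "a < u x"
  shows "\<forall>\<^sub>F y in at x. a < u y"
proof -
  have "\<forall>\<^sub>F N in sequentially. a < (\<Sum>n<N. w n x)"
    using sums[of x] \<open>a < u x\<close> unfolding sums_def by (rule order_tendstoD)
  then obtain N where N: "a < (\<Sum>n<N. w n x)" by (auto simp: eventually_sequentially)
  have "continuous_on UNIV (\<lambda>y. \<Sum>n<N. w n y)" by (intro continuous_on_sum cont)
  then have "((\<lambda>y. \<Sum>n<N. w n y) \<longlongrightarrow> (\<Sum>n<N. w n x)) (at x)" by (simp add: continuous_on_def)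
  then have "\<forall>\<^sub>F y in at x. a < (\<Sum>n<N. w n y)" using N by (rule order_tendstoD)
  then show ?thesis
  proof eventually_elim
    fix y assume "a < (\<Sum>n<N. w n y)"
    also have "\<dots> \<le> u y" using sum_le_suminf[of "\<lambda>n. w n y" "{..<N}"] sums[of y] nonneg by (simp add: sums_iff)
    finally show "a < u y" .
  qed
qed

theorem lemma2p5:
  fixes X :: "'z::banach \<Rightarrow> 'z" and \<phi> :: "real \<Rightarrow> 'z \<Rightarrow> 'z"
    and rate_r rate_b :: "'z \<Rightarrow> real" and Qr Qb Q :: "'z \<Rightarrow> 'z measure"
    and Pr :: "'z \<Rightarrow> 'w measure" and S :: "nat \<Rightarrow> 'w \<Rightarrow> ennreal" and Y :: "nat \<Rightarrow> 'w \<Rightarrow> 'z"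
    and Z :: "real \<Rightarrow> 'w \<Rightarrow> 'z"
  assumes "pdmp_data X \<phi> rate_r rate_b Qr Qb Q"
    and "assumption_W \<phi> rate_r rate_b Qr Qb"
    and "\<And>z. pdmp_from (Pr z) \<phi> (\<lambda>y. rate_r y + rate_b y) Q z S Y Z"
  shows "\<forall>t\<ge>0. transition_op Pr Z t ` bcontfun \<subseteq> bcontfun"
proof safe
  fix t :: real and f :: "'z \<Rightarrow> real" assume t: "t \<ge> 0" and "f \<in> bcontfun"
  interpret pdmp_W X \<phi> rate_r rate_b Qr Qb Q
    using assms(1,2) by (rule pdmp_W.intro)
  have process: "pdmp_W_process X \<phi> rate_r rate_b Qr Qb Q (Pr z) z S Y Z" for z
    using assms(3) by (intro pdmp_W_process.intro pdmp_W_axioms)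
  have prob: "prob_space (Pr z)" for z
    using assms(3) by (simp add: pdmp_from_def)
  have Z[measurable]: "Z t \<in> borel_measurable (Pr z)" for z
    using pdmp_from.Z_measurable[OF assms(3) t] .
  have cont: "continuous_on UNIV f" using \<open>f \<in> bcontfun\<close> by (simp add: bcontfun_def)
  have [measurable]: "f \<in> borel_measurable borel" using cont by (rule borel_measurable_continuous_onI)
  have "bounded (range f)" using \<open>f \<in> bcontfun\<close> by (simp add: bcontfun_def)
  \<comment> \<open>\<open>B\<close> is taken strictly positive, also for \<open>f = 0\<close>,
    because it is divided by below.\<close>
  then obtain B where "B > 0" and B: "\<And>x. \<bar>f x\<bar> \<le> B"
    unfolding bounded_pos by auto
  have int: "integrable (Pr z) (\<lambda>\<omega>. f (Z t \<omega>))" for z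
  proof -
    interpret prob_space "Pr z" by (rule prob)
    show ?thesis by (rule integrable_const_bound[where B = B]) (use B in auto)
  qed
  \<comment> \<open>Lower semicontinuity in the starting point for functions with values in
    \<open>[0, 1]\<close>. The terms of the series are built from the flow, the rates and
    \<open>Q\<close> alone, so the same functions of the starting point serve every measure
    \<open>Pr y\<close>.\<close>
  have gt: "\<forall>\<^sub>F y in at x. a < (\<integral>\<omega>. g (Z t \<omega>) \<partial>Pr y)"
    if g: "continuous_on UNIV g" "\<And>x. 0 \<le> g x" "\<And>x. g x \<le> 1" and a: "a < (\<integral>\<omega>. g (Z t \<omega>) \<partial>Pr x)"
    for g :: "'z \<Rightarrow> real" and a x
  proof (rule sums_nonneg_eventually_gt[where w = "\<lambda>n. (jump_op ^^ n) (no_jump g) t"])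
    have adm: "admissible ((jump_op ^^ n) (no_jump g))" for n
      by (intro jump_op_power_admissible no_jump_admissible g)
    show "continuous_on UNIV ((jump_op ^^ n) (no_jump g) t)" for n
      using adm t by (simp add: admissible_def)
    show "0 \<le> (jump_op ^^ n) (no_jump g) t y" for n y
      by (rule admissible_bounds[OF adm])
    show "(\<lambda>n. (jump_op ^^ n) (no_jump g) t y) sums (\<integral>\<omega>. g (Z t \<omega>) \<partial>Pr y)" for y
      by (rule pdmp_W_process.expectation_sums[OF process g t])
  qed (rule a)
  \<comment> \<open>The map \<open>x \<mapsto> (B + \<sigma> * x) / (2 * B)\<close> with
    \<open>\<sigma> = 1\<close> or \<open>\<sigma> = -1\<close> sends \<open>[-B, B]\<close> onto
    \<open>[0, 1]\<close> and commutes with expectation; the sign treats \<open>f\<close> and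
    \<open>-f\<close> together.\<close>
  have affine: "(\<integral>\<omega>. (B + \<sigma> * f (Z t \<omega>)) / (2 * B) \<partial>Pr y) = (B + \<sigma> * transition_op Pr Z t f y) / (2 * B)" for \<sigma> y
  proof -
    interpret prob_space "Pr y" by (rule prob)
    show ?thesis using int[of y] by (simp add: transition_op_def prob_space)
  qed
  have half: "\<forall>\<^sub>F y in at x. a < \<sigma> * transition_op Pr Z t f y"
    if "\<bar>\<sigma>\<bar> = 1" "a < \<sigma> * transition_op Pr Z t f x" for \<sigma> a x
  proof -
    have \<sigma>: "\<sigma> = 1 \<or> \<sigma> = -1" using that(1) by linarith
    have "\<forall>\<^sub>F y in at x. (B + a) / (2 * B) < (\<integral>\<omega>. (B + \<sigma> * f (Z t \<omega>)) / (2 * B) \<partial>Pr y)"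
    proof (rule gt)
      show "continuous_on UNIV (\<lambda>x. (B + \<sigma> * f x) / (2 * B))"
        using \<open>B > 0\<close> by (intro continuous_intros cont) simp
      show "0 \<le> (B + \<sigma> * f x) / (2 * B)" "(B + \<sigma> * f x) / (2 * B) \<le> 1" for x
        using \<sigma> B[of x] \<open>B > 0\<close> by (auto simp: field_simps abs_le_iff)
      show "(B + a) / (2 * B) < (\<integral>\<omega>. (B + \<sigma> * f (Z t \<omega>)) / (2 * B) \<partial>Pr x)"
        using that(2) \<open>B > 0\<close> unfolding affine by (intro divide_strict_right_mono) auto
    qed
    then show ?thesis
      unfolding affine using \<open>B > 0\<close> by (simp add: divide_less_cancel)
  qed
  \<comment> \<open>The sign 1 gives lower semicontinuity and the sign -1 upper semicontinuity,
    which together are continuity at \<open>x\<close>.\<close>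
  have "(transition_op Pr Z t f \<longlongrightarrow> transition_op Pr Z t f x) (at x)" for x
  proof (rule order_tendstoI)
    show "\<forall>\<^sub>F y in at x. a < transition_op Pr Z t f y" if "a < transition_op Pr Z t f x" for a
      using half[of 1 a x] that by simp
    show "\<forall>\<^sub>F y in at x. transition_op Pr Z t f y < a" if "transition_op Pr Z t f x < a" for a
      using half[of "-1" "-a" x] that by simp
  qed
  moreover have "\<bar>transition_op Pr Z t f y\<bar> \<le> B" for y
  proof -
    interpret prob_space "Pr y" by (rule prob)
    have "\<bar>transition_op Pr Z t f y\<bar> \<le> (\<integral>\<omega>. \<bar>f (Z t \<omega>)\<bar> \<partial>Pr y)"
      unfolding transition_op_def by (rule integral_abs_bound)
    also have "\<dots> \<le> B"
      using int[of y] B by (intro integral_le_const) auto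
    finally show ?thesis .
  qed
  ultimately show "transition_op Pr Z t f \<in> bcontfun"
    by (auto simp: bcontfun_def continuous_on_def bounded_iff)
qed

end
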